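(* For every real $R>0$, one has $A_{\mathrm{sc}}(R)=1$, where $$A_{\mathrm{sc}}(R):=\sup\left\{Q(D_1,D_2;z): D_1,D_2\in\mathcal S_R,\ z\in D_1\cap D_2\right\},\qquad Q(D_1,D_2;z):=\frac{\lambda_{D_1\cap D_2}(z)}{\lambda_{D_1}(z)+\lambda_{D_2}(z)},$$ and $\mathcal S_R$ is the class of simply connected domains contained in $\{z\in\mathbb C:|z|<R\}$.
   Context: A domain is a nonempty connected open set. A domain $G\subset\mathbb C$ is hyperbolic if $\mathbb C\setminus G$ contains at least two points (so every domain contained in $\mathbb D_R:=\{z\in\mathbb C:|z|<R\}$ is hyperbolic). For a hyperbolic domain $G$, $\lambda_G$ denotes the density of its hyperbolic metric $\lambda_G(z)\,|dz|$, normalized by $\lambda_{\mathbb D}(z)=\frac{1}{1-|z|^2}$ on the unit disk $\mathbb D$; equivalently, $\lambda_G$ is the unique function with $\lambda_G(\pi(\zeta))\,|\pi'(\zeta)|=\lambda_{\mathbb D}(\zeta)$ for all $\zeta\in\mathbb D$, for a holomorphic universal covering map $\pi:\mathbb D\to G$. Convention: if $D_1\cap D_2$ is not connected and $z\in D_1\cap D_2$, then $\lambda_{D_1\cap D_2}(z)$ means the hyperbolic density at $z$ of the connected component of $D_1\cap D_2$ containing $z$. *)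

theory Defs
  imports "HOL-Complex_Analysis.Complex_Analysis"
begin

definition complex_domain :: "complex set \<Rightarrow> bool" where
  "complex_domain G \<longleftrightarrow> G \<noteq> {} \<and> open G \<and> connected G"

definition disk_density :: "complex \<Rightarrow> real" where
  "disk_density \<zeta> = 1 / (1 - (cmod \<zeta>)\<^sup>2)"

text \<open>A covering map from the unit disk is automatically universal, the disk being simply connected.\<close>

definition holomorphic_universal_cover :: "(complex \<Rightarrow> complex) \<Rightarrow> complex set \<Rightarrow> bool" where
  "holomorphic_universal_cover p G \<longleftrightarrow>
     p holomorphic_on ball 0 1 \<and> covering_space (ball 0 1) p G"

text \<open>
  Meaningful for hyperbolic domains \<open>G\<close> and \<open>z \<in> G\<close>: a cover \<open>p\<close> then exists by uniformization,
  and the value depends neither on \<open>p\<close> nor on the preimage of \<open>z\<close>, since any two choices differ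
  by an automorphism of the disk, under which \<^const>\<open>disk_density\<close> is invariant.
  In all other cases the value is unspecified.
\<close>

definition hyperbolic_density :: "complex set \<Rightarrow> complex \<Rightarrow> real" where
  "hyperbolic_density G z =
     (THE r. \<exists>p. holomorphic_universal_cover p G \<and>
        (\<forall>\<zeta>\<in>ball 0 1. p \<zeta> = z \<longrightarrow> r * cmod (deriv p \<zeta>) = disk_density \<zeta>))"

definition sc_domains :: "real \<Rightarrow> complex set set" where
  "sc_domains R = {D. complex_domain D \<and> simply_connected D \<and> D \<subseteq> {z. cmod z < R}}"

text \<open>
  The intersection of two domains need not be connected; its density at \<open>z\<close> is by convention that
  of the component containing \<open>z\<close>, which is the whole intersection if that is connected.
\<close>

definition density_quotient :: "complex set \<Rightarrow> complex set \<Rightarrow> complex \<Rightarrow> real" where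
  "density_quotient D1 D2 z =
     hyperbolic_density (connected_component_set (D1 \<inter> D2) z) z /
     (hyperbolic_density D1 z + hyperbolic_density D2 z)"

text \<open>
  The supremum is taken in the extended reals, where it is the genuine least upper bound
  without a prior proof that the set is bounded.
\<close>

definition A_sc :: "real \<Rightarrow> ereal" where
  "A_sc R = Sup {ereal (density_quotient D1 D2 z) | D1 D2 z.
     D1 \<in> sc_domains R \<and> D2 \<in> sc_domains R \<and> z \<in> D1 \<inter> D2}"

end

theory Submission
  imports Defs
begin

text \<open>
  The lower bound comes from concentric disks of radii \<open>r\<close> and \<open>R\<close>, whose quotient at the centre
  is \<open>1 / (1 + r / R)\<close>.

  For the upper bound, \<open>\<lambda>\<^bsub>D1 \<inter> D2\<^esub> \<le> \<lambda>\<^bsub>D1\<^esub> + \<lambda>\<^bsub>D2\<^esub>\<close>, normalize so that both domains lie in the unit disk and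
  the point is 0, and let \<open>f\<close>, \<open>g\<close> be their Riemann maps. It suffices to find self-maps \<open>h\<close> of the disk
  with \<open>f \<circ> h\<close> mapping into the image of \<open>g\<close> and with \<open>1 / \<bar>h'(0)\<bar>\<close> at most about
  \<open>1 + \<bar>f'(0)\<bar> (1 / \<bar>g'(0)\<bar> - 1)\<close>. This is a discrete version of Loewner's method. As long as the image of \<open>g\<close>
  omits a point \<open>p\<close> of modulus \<open>\<sigma>\<^sup>2\<close>, close to 1, one lifts \<open>g\<close> through the two-sheeted proper self-map of the disk
  branched over \<open>p\<close>, as in Koebe's osculation proof of the Riemann mapping theorem, and carries \<open>f\<close> along,
  first branching its argument over \<open>q\<close> if \<open>f q = p\<close>. After finitely many steps the image of \<open>g\<close> contains the
  disk of radius \<open>\<sigma>\<^sup>2\<close>, where \<open>h z = \<sigma>\<^sup>2 z\<close> works. The cost of a step is controlled by Pick's inequality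
  \<open>(1 - \<bar>q\<bar>)\<^sup>2 / \<bar>q\<bar> \<le> \<bar>f'(0)\<bar> (1 - \<bar>p\<bar>)\<^sup>2 / \<bar>p\<bar>\<close>, which the same lifting procedure yields without the area theorem.
\<close>

section \<open>Two-sheeted self-maps of the disk and lifting\<close>

text \<open>For \<open>cmod p < 1\<close> this is the disk automorphism exchanging \<open>0\<close>
  and \<open>p\<close>. It is an involution, so the same formula moves a point to the origin and
  back.\<close>

definition disk_swap :: "complex \<Rightarrow> complex \<Rightarrow> complex" where
  "disk_swap p z = (p - z) / (1 - cnj p * z)"

lemma disk_swap_eq_Moebius: "disk_swap p z = Moebius_function pi p z"
  by (simp add: disk_swap_def Moebius_function_def minus_divide_left)

lemma disk_swap_0 [simp]: "disk_swap p 0 = p"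
  by (simp add: disk_swap_def)

lemma disk_swap_self [simp]: "disk_swap p p = 0"
  by (simp add: disk_swap_def)

lemma norm_disk_swap_less_1: "cmod p < 1 \<Longrightarrow> cmod z < 1 \<Longrightarrow> cmod (disk_swap p z) < 1"
  by (simp add: disk_swap_eq_Moebius Moebius_function_norm_lt_1)

lemma disk_swap_denominator_nonzero:
  assumes "cmod p < 1" "cmod z < 1"
  shows "1 - cnj p * z \<noteq> 0"
proof
  assume "1 - cnj p * z = 0"
  then have "cmod (cnj p * z) = 1"
    by (metis eq_iff_diff_eq_0 norm_one)
  then show False
    using assms norm_mult_less[of "cnj p" 1 z 1] by simp
qed

lemma disk_swap_involution:
  assumes "cmod p < 1" "cmod z < 1"
  shows "disk_swap p (disk_swap p z) = z"
proof -
  have 1: "1 - cnj p * z \<noteq> 0" and 2: "1 - cnj p * p \<noteq> 0"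
    using assms disk_swap_denominator_nonzero by auto
  have 3: "1 - cnj p * disk_swap p z \<noteq> 0"
    using assms disk_swap_denominator_nonzero norm_disk_swap_less_1 by blast
  have "disk_swap p z * (1 - cnj p * z) = p - z"
    using 1 by (simp add: disk_swap_def)
  then have "p - disk_swap p z = z * (1 - cnj p * disk_swap p z)"
    by (simp add: algebra_simps)
  with 3 show ?thesis
    by (simp add: disk_swap_def[of p "disk_swap p z"])
qed

lemma disk_swap_eq_iff:
  assumes "cmod p < 1" "cmod z < 1" "cmod w < 1"
  shows "disk_swap p z = disk_swap p w \<longleftrightarrow> z = w"
  using disk_swap_involution assms by metis

lemma disk_swap_eq_0_iff:
  assumes "cmod p < 1" "cmod z < 1"
  shows "disk_swap p z = 0 \<longleftrightarrow> z = p"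
  using disk_swap_denominator_nonzero[OF assms] by (auto simp: disk_swap_def)

lemma holomorphic_disk_swap: "cmod p < 1 \<Longrightarrow> disk_swap p holomorphic_on ball 0 1"
  using Moebius_function_holomorphic[of p pi]
  by (simp add: disk_swap_eq_Moebius[abs_def])

lemma deriv_disk_swap:
  assumes "cmod p < 1" "cmod z < 1"
  shows "deriv (disk_swap p) z = (cnj p * p - 1) / (1 - cnj p * z)\<^sup>2"
proof -
  have "(disk_swap p has_field_derivative (cnj p * p - 1) / (1 - cnj p * z)\<^sup>2) (at z)"
    unfolding disk_swap_def[abs_def]
    using disk_swap_denominator_nonzero[OF assms]
    by (auto intro!: derivative_eq_intros simp: field_simps power2_eq_square)
  then show ?thesis
    by (rule DERIV_imp_deriv)
qed

definition disk_self_map :: "(complex \<Rightarrow> complex) \<Rightarrow> bool" where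
  "disk_self_map f \<longleftrightarrow>
     f holomorphic_on ball 0 1 \<and> (\<forall>z\<in>ball 0 1. f z \<in> ball 0 1) \<and> f 0 = 0"

definition univalent_self_map :: "(complex \<Rightarrow> complex) \<Rightarrow> bool" where
  "univalent_self_map f \<longleftrightarrow> disk_self_map f \<and> inj_on f (ball 0 1)"

lemma disk_self_mapD:
  assumes "disk_self_map f"
  shows "f holomorphic_on ball 0 1" "f 0 = 0" "cmod z < 1 \<Longrightarrow> cmod (f z) < 1"
  using assms by (auto simp: disk_self_map_def)

lemma disk_self_map_Schwarz:
  assumes "disk_self_map f"
  shows "cmod z < 1 \<Longrightarrow> cmod (f z) \<le> cmod z" "cmod (deriv f 0) \<le> 1"
  using Schwarz_Lemma(1)[of f z] Schwarz_Lemma(2)[of f 0] disk_self_mapD[OF assms] by auto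

lemma univalent_deriv_0_nonzero: "univalent_self_map f \<Longrightarrow> deriv f 0 \<noteq> 0"
  unfolding univalent_self_map_def
  by (intro holomorphic_injective_imp_regular[of f "ball 0 1"]) (auto simp: disk_self_map_def)

text \<open>The factorization of \<open>g\<close> is required only on the disk, because lifts
  satisfy their functional equation only there.\<close>

lemma deriv_comp_on_disk:
  assumes u: "u holomorphic_on ball 0 1" and v: "v holomorphic_on ball 0 1"
    and a: "cmod a < 1" and va: "cmod (v a) < 1"
    and eq: "\<And>z. cmod z < 1 \<Longrightarrow> g z = u (v z)"
  shows "deriv g a = deriv u (v a) * deriv v a"
proof -
  have "deriv g a = deriv (u \<circ> v) a"
    by (rule deriv_cong_ev)
      (use a in \<open>auto intro!: eventually_mono[OF eventually_nhds_in_open[of "ball 0 1"]] eq\<close>)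
  also have "\<dots> = deriv u (v a) * deriv v a"
    using a va u v by (intro deriv_chain) (auto simp: holomorphic_on_imp_differentiable_at)
  finally show ?thesis .
qed

lemma holomorphic_on_disk_compose:
  assumes "f holomorphic_on ball 0 1" "g holomorphic_on ball 0 1"
    "\<And>z. cmod z < 1 \<Longrightarrow> cmod (g z) < 1"
  shows "(\<lambda>z. f (g z)) holomorphic_on ball 0 1"
  using holomorphic_on_compose_gen[OF assms(2,1)] assms(3) by (force simp: o_def)

lemma disk_self_map_compose:
  assumes "disk_self_map f" "disk_self_map g"
  shows "disk_self_map (\<lambda>z. f (g z))"
  using assms holomorphic_on_compose_gen[of g "ball 0 1" f "ball 0 1"]
  by (auto simp: disk_self_map_def o_def image_subset_iff)

text \<open>\<open>koebe_map s\<close> is the two-sheeted proper self-map of the disk that fixes the origin and is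
  branched over \<open>s\<^sup>2\<close>.\<close>

definition koebe_map :: "complex \<Rightarrow> complex \<Rightarrow> complex" where
  "koebe_map s z = disk_swap (s\<^sup>2) ((disk_swap s z)\<^sup>2)"

lemma norm_power2_less_1: "cmod s < 1 \<Longrightarrow> cmod (s\<^sup>2) < 1"
  using norm_mult_less[of s 1 s 1] by (simp add: power2_eq_square)

lemma disk_self_map_koebe:
  assumes "cmod s < 1"
  shows "disk_self_map (koebe_map s)"
proof -
  note s2 = norm_power2_less_1[OF assms]
  have "(disk_swap (s\<^sup>2) \<circ> (\<lambda>z. (disk_swap s z)\<^sup>2)) holomorphic_on ball 0 1"
    using assms s2 holomorphic_disk_swap[of s] holomorphic_disk_swap[of "s\<^sup>2"]
    by (intro holomorphic_on_compose_gen[where t="ball 0 1"] holomorphic_intros)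
      (auto intro!: norm_power2_less_1 norm_disk_swap_less_1)
  then show ?thesis
    using assms s2
    by (auto simp: disk_self_map_def koebe_map_def[abs_def] o_def
        intro!: norm_disk_swap_less_1 norm_power2_less_1)
qed

text \<open>The modulus of the derivative of \<open>koebe_map s\<close> at 0 when
  \<open>cmod s = x\<close>: the factor by which lifting through that map changes derivatives at the
  origin.\<close>

definition koebe_rate :: "real \<Rightarrow> real" where
  "koebe_rate x = 2 * x / (1 + x\<^sup>2)"

lemma norm_deriv_koebe:
  assumes "cmod s < 1"
  shows "cmod (deriv (koebe_map s) 0) = koebe_rate (cmod s)"
proof -
  note s2 = norm_power2_less_1[OF assms]
  have "deriv (koebe_map s) 0 = deriv (disk_swap (s\<^sup>2)) ((disk_swap s 0)\<^sup>2) * deriv (\<lambda>z. (disk_swap s z)\<^sup>2) 0"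
    using assms s2
    by (intro deriv_comp_on_disk holomorphic_disk_swap holomorphic_intros)
      (auto simp: koebe_map_def)
  also have "deriv (\<lambda>z. (disk_swap s z)\<^sup>2) 0 = 2 * disk_swap s 0 * deriv (disk_swap s) 0"
  proof -
    have "(disk_swap s has_field_derivative deriv (disk_swap s) 0) (at 0)"
      using holomorphic_disk_swap[OF assms] by (intro holomorphic_derivI[of _ "ball 0 1"]) auto
    then have "((\<lambda>z. (disk_swap s z)\<^sup>2) has_field_derivative
        2 * disk_swap s 0 * deriv (disk_swap s) 0) (at 0)"
      by (auto intro!: derivative_eq_intros)
    then show ?thesis
      by (rule DERIV_imp_deriv)
  qed
  finally have "cmod (deriv (koebe_map s) 0) =
      cmod ((cnj (s\<^sup>2) * s\<^sup>2 - 1) / (1 - cnj (s\<^sup>2) * s\<^sup>2)\<^sup>2 * (2 * s * (cnj s * s - 1)))"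
    using assms s2 by (simp add: deriv_disk_swap)
  also have "cnj (s\<^sup>2) * s\<^sup>2 = of_real ((cmod s)^4)"
    using complex_norm_square[of "s\<^sup>2"] by (simp add: norm_power mult.commute)
  also have "cnj s * s = of_real ((cmod s)\<^sup>2)"
    using complex_norm_square[of s] by (simp add: mult.commute)
  also have "cmod ((of_real ((cmod s)^4) - 1) / (1 - of_real ((cmod s)^4))\<^sup>2 * (2 * s * (of_real ((cmod s)\<^sup>2) - 1)))
      = \<bar>(cmod s)^4 - 1\<bar> / \<bar>1 - (cmod s)^4\<bar>\<^sup>2 * (2 * cmod s * \<bar>(cmod s)\<^sup>2 - 1\<bar>)"
  proof -
    have "cmod (of_real a - 1) = \<bar>a - 1\<bar>" "cmod (1 - of_real a) = \<bar>1 - a\<bar>" for a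
      by (metis norm_of_real of_real_1 of_real_diff)+
    then show ?thesis
      by (simp only: norm_mult norm_divide norm_power norm_numeral)
  qed
  also have "\<dots> = koebe_rate (cmod s)"
  proof -
    define x where "x = (cmod s)\<^sup>2"
    have x: "0 \<le> x" "x < 1" "(cmod s)^4 = x\<^sup>2"
      using s2 by (auto simp: x_def norm_power)
    have "x\<^sup>2 < 1"
      using x by (simp add: abs_square_less_1)
    then have eqs: "\<bar>x\<^sup>2 - 1\<bar> = (1 - x) * (1 + x)" "\<bar>1 - x\<^sup>2\<bar> = (1 - x) * (1 + x)" "\<bar>x - 1\<bar> = 1 - x"
      using x by (auto simp: algebra_simps power2_eq_square)
    have "(1 - x) * (1 + x) / ((1 - x) * (1 + x))\<^sup>2 * (2 * c * (1 - x)) = 2 * c / (1 + x)" for c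
      using x by (simp add: power2_eq_square)
    then show ?thesis
      unfolding koebe_rate_def x(3) x_def[symmetric] eqs .
  qed
  finally show ?thesis .
qed

lemma koebe_rate_bounds:
  assumes "0 < x" "x < 1"
  shows "0 < koebe_rate x" "koebe_rate x < 1"
proof -
  have "0 < 1 + x\<^sup>2" by (simp add: add_pos_nonneg)
  moreover have "0 < (1 - x)\<^sup>2" using assms by simp
  ultimately show "0 < koebe_rate x" "koebe_rate x < 1"
    using assms by (auto simp: koebe_rate_def divide_simps power2_eq_square algebra_simps)
qed

section \<open>Square roots and lifts through \<open>koebe_map\<close>\<close>

lemma holomorphic_sqrt_on_disk:
  assumes "f holomorphic_on ball 0 1" "\<And>z. cmod z < 1 \<Longrightarrow> f z \<noteq> 0"
    "cmod a < 1" "f a = c\<^sup>2"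
  obtains g where "g holomorphic_on ball 0 1" "\<And>z. cmod z < 1 \<Longrightarrow> f z = (g z)\<^sup>2" "g a = c"
proof -
  obtain g where g: "g holomorphic_on ball 0 1" "\<And>z. z \<in> ball 0 1 \<Longrightarrow> f z = (g z)\<^sup>2"
    using contractible_imp_holomorphic_sqrt[of f "ball 0 1"] assms
    by (auto simp: convex_imp_contractible)
  then have "(g a)\<^sup>2 = c\<^sup>2" using assms(3,4) by simp
  then consider "g a = c" | "g a = - c" by (auto simp: power2_eq_iff)
  then show thesis
  proof cases
    case 1
    then show thesis using g that by simp
  next
    case 2
    then show thesis using g that[of "\<lambda>z. - g z"] by (auto intro: holomorphic_intros)
  qed
qed

text \<open>The lift is \<open>disk_swap s\<close> after \<open>v\<close>: the inner swap of
  \<open>koebe_map s\<close> is undone, squaring \<open>v\<close> gives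
  \<open>disk_swap (s\<^sup>2) (u z)\<close>, and the outer swap returns \<open>u z\<close>. The
  choice \<open>v 0 = s\<close> makes the lift fix the origin.\<close>

lemma koebe_lift_of_sqrt:
  assumes s: "cmod s < 1" and hol: "v holomorphic_on ball 0 1" and v0: "v 0 = s"
    and u: "\<And>z. cmod z < 1 \<Longrightarrow> cmod (u z) < 1"
    and eq: "\<And>z. cmod z < 1 \<Longrightarrow> (v z)\<^sup>2 = disk_swap (s\<^sup>2) (u z)"
    and inj: "inj_on v (ball 0 1)"
  obtains w where "univalent_self_map w" "\<And>z. cmod z < 1 \<Longrightarrow> koebe_map s (w z) = u z"
proof
  note s2 = norm_power2_less_1[OF s]
  have nv: "cmod (v z) < 1" if "cmod z < 1" for z
  proof -
    have "cmod ((v z)\<^sup>2) < 1"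
      using eq[OF that] norm_disk_swap_less_1[OF s2 u[OF that]] by simp
    then show ?thesis
      by (simp add: norm_power abs_square_less_1)
  qed
  have "(disk_swap s \<circ> v) holomorphic_on ball 0 1"
    using nv by (intro holomorphic_on_compose_gen[OF hol holomorphic_disk_swap[OF s]]) auto
  moreover have "inj_on (\<lambda>z. disk_swap s (v z)) (ball 0 1)"
    using inj nv s by (auto simp: inj_on_def disk_swap_eq_iff)
  ultimately show "univalent_self_map (\<lambda>z. disk_swap s (v z))"
    using nv s v0
    by (auto simp: univalent_self_map_def disk_self_map_def o_def norm_disk_swap_less_1)
  show "koebe_map s (disk_swap s (v z)) = u z" if "cmod z < 1" for z
    using that nv s s2 u eq by (simp add: koebe_map_def disk_swap_involution)
qed

text \<open>Moving the omitted point to 0 makes the composite zero-free, so it has a square root;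
  this root is injective because its square already is.\<close>

lemma koebe_lift_omitted:
  assumes f: "univalent_self_map f" and s: "cmod s < 1"
    and omit: "s\<^sup>2 \<notin> f ` ball 0 1"
  obtains w where "univalent_self_map w" "\<And>z. cmod z < 1 \<Longrightarrow> koebe_map s (w z) = f z"
proof -
  note s2 = norm_power2_less_1[OF s]
  have fD: "f holomorphic_on ball 0 1" "f 0 = 0" "\<And>z. cmod z < 1 \<Longrightarrow> cmod (f z) < 1"
      "inj_on f (ball 0 1)"
    using f by (auto simp: univalent_self_map_def disk_self_map_def)
  have "(disk_swap (s\<^sup>2) \<circ> f) holomorphic_on ball 0 1"
    using fD by (intro holomorphic_on_compose_gen[OF _ holomorphic_disk_swap[OF s2]]) auto
  moreover have "disk_swap (s\<^sup>2) (f z) \<noteq> 0" if "cmod z < 1" for z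
    using that omit fD s2 disk_swap_eq_0_iff[OF s2 fD(3)[OF that]] by (metis imageI mem_ball_0)
  ultimately obtain v where v: "v holomorphic_on ball 0 1"
      "\<And>z. cmod z < 1 \<Longrightarrow> disk_swap (s\<^sup>2) (f z) = (v z)\<^sup>2" "v 0 = s"
    using holomorphic_sqrt_on_disk[of "\<lambda>z. disk_swap (s\<^sup>2) (f z)" 0 s] fD by (auto simp: o_def)
  have "inj_on v (ball 0 1)"
  proof (rule inj_onI)
    fix x y assume xy: "x \<in> ball 0 1" "y \<in> ball 0 1" "v x = v y"
    then have "disk_swap (s\<^sup>2) (f x) = disk_swap (s\<^sup>2) (f y)"
      using v by simp
    then have "f x = f y"
      using xy fD s2 by (simp add: disk_swap_eq_iff)
    then show "x = y"
      using fD xy by (auto dest: inj_onD)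
  qed
  then show thesis
    using koebe_lift_of_sqrt[OF s v(1,3), of f] v(2) fD that by auto
qed

text \<open>When \<open>f\<close> attains the branch point, one first has to branch its argument. The square root of the
  pulled-back double zero is taken as \<open>disk_swap t z * R ((disk_swap t z)\<^sup>2)\<close>, which keeps it odd in
  \<open>disk_swap t z\<close> and so makes the lift injective although \<open>koebe_map t\<close> is not.\<close>

lemma koebe_lift_attained:
  assumes f: "univalent_self_map f" and s: "cmod s < 1" and t: "cmod t < 1" "t \<noteq> 0"
    and ft: "f (t\<^sup>2) = s\<^sup>2"
  obtains w where "univalent_self_map w"
    "\<And>z. cmod z < 1 \<Longrightarrow> koebe_map s (w z) = f (koebe_map t z)"
proof -
  note s2 = norm_power2_less_1[OF s] and t2 = norm_power2_less_1[OF t(1)]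
  have fD: "f holomorphic_on ball 0 1" "f 0 = 0" "\<And>z. cmod z < 1 \<Longrightarrow> cmod (f z) < 1"
      "inj_on f (ball 0 1)"
    using f by (auto simp: univalent_self_map_def disk_self_map_def)
  \<comment> \<open>The two swaps carry the points \<open>t\<^sup>2\<close> and
    \<open>s\<^sup>2\<close> to 0, so \<open>G\<close> is injective with a simple zero at 0 and
    \<open>G z / z\<close> is zero-free.\<close>
  define G where "G z = disk_swap (s\<^sup>2) (f (disk_swap (t\<^sup>2) z))" for z
  have "(\<lambda>z. f (disk_swap (t\<^sup>2) z)) holomorphic_on ball 0 1"
    by (rule holomorphic_on_disk_compose[OF fD(1) holomorphic_disk_swap[OF t2]
          norm_disk_swap_less_1[OF t2]])
  then have holG: "G holomorphic_on ball 0 1"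
    unfolding G_def[abs_def]
    by (rule holomorphic_on_disk_compose[OF holomorphic_disk_swap[OF s2]])
      (rule fD(3)[OF norm_disk_swap_less_1[OF t2]])
  have injG: "inj_on G (ball 0 1)"
  proof (rule inj_onI)
    fix x y assume xy: "x \<in> ball 0 1" "y \<in> ball 0 1" "G x = G y"
    then have "f (disk_swap (t\<^sup>2) x) = f (disk_swap (t\<^sup>2) y)"
      using fD(3) s2 t2 by (simp add: G_def disk_swap_eq_iff norm_disk_swap_less_1)
    then have "disk_swap (t\<^sup>2) x = disk_swap (t\<^sup>2) y"
      using fD(4) xy t2 by (simp add: inj_on_def norm_disk_swap_less_1)
    then show "x = y"
      using xy t2 by (simp add: disk_swap_eq_iff)
  qed
  have G0: "G 0 = 0"
    by (simp add: G_def ft)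
  obtain W where W: "W holomorphic_on ball 0 1" "\<And>z. cmod z < 1 \<Longrightarrow> G z = z * W z"
      "deriv G 0 = W 0"
    using Schwarz3[OF holG G0] by metis
  have Wnz: "W z \<noteq> 0" if "cmod z < 1" for z
  proof (cases "z = 0")
    case True
    then show ?thesis
      using holomorphic_injective_imp_regular[OF holG _ injG, of 0] W(3) by simp
  next
    case False
    then have "G z \<noteq> G 0"
      using injG that by (auto dest: inj_onD)
    then show ?thesis
      using W(2)[OF that] G0 by auto
  qed
  \<comment> \<open>This value prescribes the sign of the root \<open>R\<close> so that
    \<open>v 0 = t * (s / t) = s\<close>.\<close>
  have "G (t\<^sup>2) = s\<^sup>2"
    using fD by (simp add: G_def)
  then have "W (t\<^sup>2) = (s / t)\<^sup>2"
    using W(2)[OF t2] t(2) by (simp add: power_divide field_simps)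
  then obtain R where R: "R holomorphic_on ball 0 1" "\<And>z. cmod z < 1 \<Longrightarrow> W z = (R z)\<^sup>2"
      "R (t\<^sup>2) = s / t"
    using holomorphic_sqrt_on_disk[OF W(1) Wnz t2] by metis
  define v where "v z = disk_swap t z * R ((disk_swap t z)\<^sup>2)" for z
  have nt: "cmod (disk_swap t z) < 1" "cmod ((disk_swap t z)\<^sup>2) < 1" if "cmod z < 1" for z
    using norm_disk_swap_less_1[OF t(1) that] norm_power2_less_1 by blast+
  have "(R \<circ> (\<lambda>z. (disk_swap t z)\<^sup>2)) holomorphic_on ball 0 1"
    using nt holomorphic_disk_swap[OF t(1)]
    by (intro holomorphic_on_compose_gen[OF _ R(1)] holomorphic_intros) auto
  then have holv: "v holomorphic_on ball 0 1"
    unfolding v_def[abs_def] o_def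
    using holomorphic_disk_swap[OF t(1)] by (intro holomorphic_intros) auto
  have v0: "v 0 = s"
    using t(2) R(3) by (simp add: v_def)
  have vsq: "(v z)\<^sup>2 = G ((disk_swap t z)\<^sup>2)" if "cmod z < 1" for z
    using W(2) R(2) nt[OF that] by (simp add: v_def power_mult_distrib)
  have injv: "inj_on v (ball 0 1)"
  proof (rule inj_onI)
    fix x y assume xy: "x \<in> ball 0 1" "y \<in> ball 0 1" "v x = v y"
    then have "G ((disk_swap t x)\<^sup>2) = G ((disk_swap t y)\<^sup>2)"
      using vsq by (metis mem_ball_0)
    then have sq: "(disk_swap t x)\<^sup>2 = (disk_swap t y)\<^sup>2"
      using injG xy nt by (auto dest: inj_onD)
    \<comment> \<open>Both values of \<open>R\<close> have the same nonzero argument value, so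
      cancelling them in \<open>v x = v y\<close> settles the sign that the squares leave
      open.\<close>
    moreover have "R ((disk_swap t x)\<^sup>2) \<noteq> 0"
      using R(2) Wnz nt xy by force
    ultimately have "disk_swap t x = disk_swap t y"
      using xy(3) by (simp add: v_def)
    then show "x = y"
      using xy t by (simp add: disk_swap_eq_iff)
  qed
  have "(v z)\<^sup>2 = disk_swap (s\<^sup>2) (f (koebe_map t z))" if "cmod z < 1" for z
    using vsq[OF that] by (simp add: G_def koebe_map_def)
  moreover have "cmod (f (koebe_map t z)) < 1" if "cmod z < 1" for z
    using fD(3) disk_self_mapD(3)[OF disk_self_map_koebe[OF t(1)] that] by blast
  ultimately show thesis
    using koebe_lift_of_sqrt[OF s holv v0 _ _ injv, of "\<lambda>z. f (koebe_map t z)"] that by blast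
qed

section \<open>Schwarz-Pick estimates\<close>

lemma norm_Moebius_diff:
  "(cmod (1 - cnj a * w))\<^sup>2 = (cmod (w - a))\<^sup>2 + (1 - (cmod a)\<^sup>2) * (1 - (cmod w)\<^sup>2)"
  by (cases a; cases w) (simp only: cmod_power2; simp add: algebra_simps power2_eq_square)

text \<open>Schwarz's lemma for \<open>disk_swap (\<psi> 0)\<close> after \<open>\<psi>\<close>
  bounds the pseudohyperbolic distance from \<open>\<psi> 0\<close> to \<open>\<psi> q\<close> by
  \<open>cmod q\<close>; the rest replaces these two points by their moduli.\<close>

lemma Schwarz_Pick_at_0:
  assumes hol: "\<psi> holomorphic_on ball 0 1" and b: "\<And>z. cmod z < 1 \<Longrightarrow> cmod (\<psi> z) < 1"
    and q: "cmod q < 1"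
  shows "cmod (\<psi> q) * (1 + cmod (\<psi> 0) * cmod q) \<le> cmod q + cmod (\<psi> 0)"
proof -
  define A where "A = cmod (\<psi> 0)"
  define W where "W = cmod (\<psi> q)"
  define x where "x = cmod q"
  have A: "0 \<le> A" "A < 1" and W: "0 \<le> W" "W < 1" and x: "0 \<le> x" "x < 1"
    using b[of 0] b[OF q] q by (auto simp: A_def W_def x_def)
  have "(disk_swap (\<psi> 0) \<circ> \<psi>) holomorphic_on ball 0 1"
    using b A by (intro holomorphic_on_compose_gen[OF hol holomorphic_disk_swap]) (auto simp: A_def)
  then have "disk_self_map (\<lambda>z. disk_swap (\<psi> 0) (\<psi> z))"
    using b A by (auto simp: disk_self_map_def o_def A_def norm_disk_swap_less_1)
  from disk_self_map_Schwarz(1)[OF this q]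
  have "cmod (\<psi> 0 - \<psi> q) \<le> x * cmod (1 - cnj (\<psi> 0) * \<psi> q)"
    using disk_swap_denominator_nonzero[of "\<psi> 0" "\<psi> q"] b q
    by (simp add: disk_swap_def norm_divide x_def divide_simps)
  then have "(cmod (\<psi> q - \<psi> 0))\<^sup>2 \<le> x\<^sup>2 * (cmod (1 - cnj (\<psi> 0) * \<psi> q))\<^sup>2"
    by (metis norm_ge_zero norm_minus_commute power_mono power_mult_distrib)
  also have "\<dots> = x\<^sup>2 * (cmod (\<psi> q - \<psi> 0))\<^sup>2 + x\<^sup>2 * ((1 - A\<^sup>2) * (1 - W\<^sup>2))"
    unfolding norm_Moebius_diff A_def W_def by (simp add: distrib_left)
  finally have *: "(1 - x\<^sup>2) * (cmod (\<psi> q - \<psi> 0))\<^sup>2 \<le> x\<^sup>2 * ((1 - A\<^sup>2) * (1 - W\<^sup>2))"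
    by (simp add: algebra_simps)
  have "W * (1 + A * x) \<le> x + A"
  proof (cases "W \<le> A")
    case True
    have "W * (A * x) \<le> 1 * x"
      using A W x by (intro mult_mono) (auto simp: mult_le_one mult_left_le_one_le)
    then show ?thesis
      using True by (simp add: algebra_simps)
  next
    case False
    have "W - A \<le> cmod (\<psi> q - \<psi> 0)"
      unfolding W_def A_def by (rule norm_triangle_ineq2)
    then have "(1 - x\<^sup>2) * (W - A)\<^sup>2 \<le> (1 - x\<^sup>2) * (cmod (\<psi> q - \<psi> 0))\<^sup>2"
      using False x by (intro mult_left_mono power_mono) (auto simp: abs_square_le_1)
    also note *
    \<comment> \<open>By the real case of \<open>norm_Moebius_diff\<close>,
      \<open>(1 - A * W)^2 = (W - A)^2 + (1 - A^2) * (1 - W^2)\<close>.\<close>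
    finally have "(W - A)\<^sup>2 \<le> (x * (1 - A * W))\<^sup>2"
      by (simp add: algebra_simps power2_eq_square)
    moreover have "0 \<le> x * (1 - A * W)"
      using x A W by (simp add: mult_le_one)
    ultimately have "W - A \<le> x * (1 - A * W)"
      by (rule power2_le_imp_le)
    then show ?thesis
      by (simp add: algebra_simps)
  qed
  then show ?thesis
    by (simp add: A_def W_def x_def)
qed

text \<open>This is \<open>Schwarz_Pick_at_0\<close> for the quotient \<open>f z / z\<close>, whose
  value at 0 is \<open>deriv f 0\<close>. For \<open>b = 1\<close> the quotient does not map into
  the open disk, and Schwarz's lemma alone suffices.\<close>

lemma disk_self_map_growth:
  assumes f: "disk_self_map f" and q: "cmod q < 1"
  defines "b \<equiv> cmod (deriv f 0)"
  shows "cmod (f q) * (1 + b * cmod q) \<le> cmod q * (cmod q + b)"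
proof (cases "b = 1")
  case True
  then show ?thesis
    using mult_right_mono[OF disk_self_map_Schwarz(1)[OF f q], of "1 + cmod q"]
    by (simp add: add.commute)
next
  case False
  note fD = disk_self_mapD[OF f]
  obtain \<psi> where \<psi>: "\<psi> holomorphic_on ball 0 1" "\<And>z. cmod z < 1 \<Longrightarrow> f z = z * \<psi> z"
      "deriv f 0 = \<psi> 0"
    using Schwarz3[OF fD(1,2)] by metis
  have b: "b < 1"
    using False disk_self_map_Schwarz(2)[OF f] by (auto simp: b_def)
  have "cmod (\<psi> z) < 1" if z: "cmod z < 1" for z
  proof (cases "z = 0")
    case True
    then show ?thesis using b \<psi>(3) by (simp add: b_def)
  next
    case nz: False
    \<comment> \<open>Equality in Schwarz's lemma would make \<open>f\<close> a rotation, hence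
      \<open>b = 1\<close>.\<close>
    have "cmod (f z) \<noteq> cmod z"
    proof
      assume eq: "cmod (f z) = cmod z"
      obtain \<alpha> where \<alpha>: "\<forall>z. cmod z < 1 \<longrightarrow> f z = \<alpha> * z" "cmod \<alpha> = 1"
        using Schwarz_Lemma(3)[OF fD(1,2) fD(3), of 0] nz z eq by auto
      have "deriv f 0 = deriv (\<lambda>z. \<alpha> * z) 0"
        by (rule deriv_cong_ev)
          (use \<alpha>(1) in \<open>auto intro!: eventually_mono[OF eventually_nhds_in_open[of "ball 0 1"]]\<close>)
      then have "b = 1"
        using \<alpha>(2) by (simp add: b_def)
      with False show False by simp
    qed
    then have "cmod z * cmod (\<psi> z) < cmod z * 1"
      using disk_self_map_Schwarz(1)[OF f z] \<psi>(2)[OF z] by (simp add: norm_mult)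
    then show ?thesis
      using nz by simp
  qed
  then have "cmod (\<psi> q) * (1 + b * cmod q) \<le> cmod q + b"
    using Schwarz_Pick_at_0[OF \<psi>(1) _ q] \<psi>(3) by (simp add: b_def)
  from mult_left_mono[OF this, of "cmod q"] show ?thesis
    using \<psi>(2)[OF q] by (simp add: norm_mult mult.assoc)
qed

text \<open>The point is the quadratic contact at \<open>b = 1\<close>: the factor \<open>((1 + b) / 2)\<^sup>2\<close> exceeds \<open>b\<close> only by
  \<open>((1 - b) / 2)\<^sup>2\<close>, so the loss is negligible along a composition of many maps with \<open>b\<close> close to 1.\<close>

lemma disk_self_map_boundary_distance:
  assumes f: "disk_self_map f" and q: "cmod q < 1"
  defines "b \<equiv> cmod (deriv f 0)"
  shows "(1 - cmod q)\<^sup>2 * cmod (f q) \<le> ((1 + b) / 2)\<^sup>2 * (1 - cmod (f q))\<^sup>2 * cmod q"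
proof -
  define x where "x = cmod q"
  define P where "P = cmod (f q)"
  define N where "N = x * (x + b)"
  define D where "D = 1 + b * x"
  have x: "0 \<le> x" "x < 1" and b: "0 \<le> b" "b \<le> 1" and P: "0 \<le> P" "P < 1"
    using q disk_self_map_Schwarz(2)[OF f] disk_self_mapD(3)[OF f q] by (auto simp: x_def b_def P_def)
  have D: "D > 0" using x b by (simp add: D_def add_pos_nonneg)
  have PD: "P * D \<le> N"
    using disk_self_map_growth[OF f q] by (simp add: P_def D_def N_def x_def b_def mult.commute)
  have DN: "D - N = 1 - x\<^sup>2" by (simp add: D_def N_def algebra_simps power2_eq_square)
  have "x\<^sup>2 < 1" using x by (simp add: abs_square_less_1)
  then have ND: "0 < D - N" using DN by simp
  have N0: "0 \<le> N" using x b by (simp add: N_def)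
  \<comment> \<open>The function \<open>P / (1 - P)^2\<close> increases on \<open>[0, 1)\<close>;
    this is its monotonicity for \<open>P \<le> N / D\<close>, cleared of denominators.\<close>
  have key: "P * (D - N)\<^sup>2 \<le> (1 - P)\<^sup>2 * N * D"
  proof -
    have "N * P \<le> D * 1" using ND P N0 D by (intro mult_mono) auto
    then have "0 \<le> (N - P * D) * (D - N * P)"
      using PD by (intro mult_nonneg_nonneg) auto
    then show ?thesis by (simp add: algebra_simps power2_eq_square)
  qed
  \<comment> \<open>The arithmetic-geometric mean inequality, since
    \<open>(x + b) + (1 + b * x) = (1 + b) * (1 + x)\<close>.\<close>
  have amgm: "(x + b) * D \<le> ((1 + b) / 2)\<^sup>2 * (1 + x)\<^sup>2"
  proof -
    have "((x + b) + D)\<^sup>2 = (1 + b)\<^sup>2 * (1 + x)\<^sup>2"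
      by (simp add: D_def power_mult_distrib[symmetric]) (simp add: algebra_simps)
    moreover have "4 * ((x + b) * D) \<le> ((x + b) + D)\<^sup>2"
      using zero_le_power2[of "(x + b) - D"] by (simp add: power2_eq_square algebra_simps)
    ultimately show ?thesis by (simp add: power_divide)
  qed
  have "(1 + x)\<^sup>2 * ((1 - x)\<^sup>2 * P) = P * (D - N)\<^sup>2"
    unfolding DN by (simp add: power2_eq_square algebra_simps)
  also note key
  also have "(1 - P)\<^sup>2 * N * D = (1 - P)\<^sup>2 * x * ((x + b) * D)"
    by (simp add: N_def)
  also have "\<dots> \<le> (1 - P)\<^sup>2 * x * (((1 + b) / 2)\<^sup>2 * (1 + x)\<^sup>2)"
    using x by (intro mult_left_mono amgm) auto
  also have "\<dots> = (1 + x)\<^sup>2 * (((1 + b) / 2)\<^sup>2 * (1 - P)\<^sup>2 * x)"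
    by (simp add: algebra_simps)
  finally have "(1 - x)\<^sup>2 * P \<le> ((1 + b) / 2)\<^sup>2 * (1 - P)\<^sup>2 * x"
    using x by (subst (asm) mult_le_cancel_left_pos) auto
  then show ?thesis by (simp add: x_def P_def)
qed

text \<open>Both logarithms are compared with \<open>b - 1\<close> through
  \<open>ln y \<le> y - 1\<close>. In the form \<open>b powr b\<close>, the errors of successive
  lifts multiply to a power of the total change of derivative.\<close>

lemma half_sum_square_le_powr:
  fixes b :: real
  assumes "0 < b" "b \<le> 1"
  shows "((1 + b) / 2)\<^sup>2 \<le> b powr b"
proof -
  have "ln ((1 + b) / 2) \<le> (1 + b) / 2 - 1"
    using assms by (intro ln_le_minus_one) auto
  moreover have "ln (1 / b) \<le> 1 / b - 1"
    using assms by (intro ln_le_minus_one) auto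
  then have "b * (1 - 1 / b) \<le> b * ln b"
    using assms by (intro mult_left_mono) (auto simp: ln_div)
  then have "b - 1 \<le> b * ln b"
    using assms by (simp add: algebra_simps)
  ultimately have "2 * ln ((1 + b) / 2) \<le> b * ln b"
    by (simp add: field_simps)
  then have "ln (((1 + b) / 2)\<^sup>2) \<le> ln (b powr b)"
    using assms by (simp add: ln_powr ln_realpow)
  then show ?thesis
    using assms by (subst (asm) ln_le_cancel_iff) auto
qed

section \<open>Pick's inequality\<close>

lemma subordinate_imp_disk_self_map:
  assumes f: "f holomorphic_on ball 0 1" "inj_on f (ball 0 1)"
    and u: "u holomorphic_on ball 0 1" "u ` ball 0 1 \<subseteq> f ` ball 0 1" "u 0 = f 0"
  obtains w where "disk_self_map w" "\<And>z. cmod z < 1 \<Longrightarrow> u z = f (w z)"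
proof -
  obtain g where g: "g holomorphic_on f ` ball 0 1" "\<And>z. z \<in> ball 0 1 \<Longrightarrow> g (f z) = z"
    using holomorphic_has_inverse[OF f(1) open_ball f(2)] by metis
  have "(g \<circ> u) holomorphic_on ball 0 1"
    using u(2) by (intro holomorphic_on_compose_gen[OF u(1) g(1)]) auto
  moreover have "g (u z) \<in> ball 0 1 \<and> f (g (u z)) = u z" if "z \<in> ball 0 1" for z
  proof -
    obtain x where "x \<in> ball 0 1" "u z = f x"
      using u(2) \<open>z \<in> ball 0 1\<close> by blast
    then show ?thesis using g(2) by simp
  qed
  moreover have "g (u 0) = 0"
    using u(3) g(2) by simp
  ultimately show thesis
    by (intro that[of "\<lambda>z. g (u z)"]) (auto simp: disk_self_map_def o_def)
qed

lemma subordinate_deriv_le: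
  assumes f: "f holomorphic_on ball 0 1" "inj_on f (ball 0 1)"
    and u: "u holomorphic_on ball 0 1" "u ` ball 0 1 \<subseteq> f ` ball 0 1" "u 0 = f 0"
  shows "cmod (deriv u 0) \<le> cmod (deriv f 0)"
proof -
  obtain w where w: "disk_self_map w" "\<And>z. cmod z < 1 \<Longrightarrow> u z = f (w z)"
    using subordinate_imp_disk_self_map[OF assms] by blast
  have "deriv u 0 = deriv f (w 0) * deriv w 0"
    using w disk_self_mapD[OF w(1)] f by (intro deriv_comp_on_disk) auto
  then have "cmod (deriv u 0) = cmod (deriv f 0) * cmod (deriv w 0)"
    using disk_self_mapD[OF w(1)] by (simp add: norm_mult)
  then show ?thesis
    using disk_self_map_Schwarz(2)[OF w(1)] by (simp add: mult_left_le)
qed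

lemma simply_connected_univalent_image:
  assumes "f holomorphic_on ball 0 1" "inj_on f (ball 0 1)"
  shows "open (f ` ball 0 1)" "simply_connected (f ` ball 0 1)"
proof -
  show "open (f ` ball 0 1)"
    using open_mapping_thm3[of f "ball 0 1"] assms by auto
  obtain g where "homeomorphism (ball 0 1) (f ` ball 0 1) f g"
    using invariance_of_domain_homeomorphism[of "ball 0 1" f] assms
    by (auto simp: holomorphic_on_imp_continuous_on)
  then have "ball (0::complex) 1 homeomorphic f ` ball 0 1"
    unfolding homeomorphic_def by blast
  then show "simply_connected (f ` ball 0 1)"
    using homeomorphic_simply_connected_eq convex_imp_simply_connected[of "ball 0 1"] by auto
qed

text \<open>A simply connected open image contains the inside of every circle it contains. So if the
  disk is not covered, some point of modulus exactly \<open>r\<close> is omitted.\<close>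

lemma sphere_subset_imp_ball_subset:
  assumes f: "univalent_self_map f" and r: "0 < r" and sph: "sphere 0 r \<subseteq> f ` ball 0 1"
  shows "ball 0 r \<subseteq> f ` ball 0 1"
proof -
  have "inside (sphere (0::complex) r) = ball 0 r"
    using inside_frontier_eq_interior[of "cball (0::complex) r"] by simp
  then show ?thesis
    using subset_simply_connected_imp_inside_subset[OF _ _ sph]
      simply_connected_univalent_image[of f] f
    by (auto simp: univalent_self_map_def disk_self_map_def)
qed

lemma deriv_koebe_comp:
  assumes w: "disk_self_map w" and s: "cmod s < 1"
    and eq: "\<And>z. cmod z < 1 \<Longrightarrow> koebe_map s (w z) = u z"
  shows "cmod (deriv u 0) = koebe_rate (cmod s) * cmod (deriv w 0)"
proof -
  have "deriv u 0 = deriv (koebe_map s) (w 0) * deriv w 0"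
    using disk_self_mapD[OF w] disk_self_mapD[OF disk_self_map_koebe[OF s]] eq
    by (intro deriv_comp_on_disk) auto
  then show ?thesis
    using disk_self_mapD[OF w] norm_deriv_koebe[OF s] by (simp add: norm_mult)
qed

lemma deriv_comp_koebe:
  assumes f: "disk_self_map f" and t: "cmod t < 1"
  shows "cmod (deriv (\<lambda>z. f (koebe_map t z)) 0) = cmod (deriv f 0) * koebe_rate (cmod t)"
proof -
  note kD = disk_self_mapD[OF disk_self_map_koebe[OF t]]
  have "deriv (\<lambda>z. f (koebe_map t z)) 0 = deriv f (koebe_map t 0) * deriv (koebe_map t) 0"
    using disk_self_mapD[OF f] kD by (intro deriv_comp_on_disk) auto
  then show ?thesis
    using kD norm_deriv_koebe[OF t] by (simp add: norm_mult)
qed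

text \<open>The dichotomy that drives both inductions below. Branch points of the fixed modulus
  \<open>\<sigma>\<^sup>2\<close> make every lift change the derivative by the same factor.\<close>

lemma koebe_lift_or_ball_subset:
  assumes f: "univalent_self_map f" and \<sigma>: "0 < \<sigma>" "\<sigma> < 1"
  obtains s w where "cmod s = \<sigma>" "univalent_self_map w"
      "\<And>z. cmod z < 1 \<Longrightarrow> koebe_map s (w z) = f z"
      "cmod (deriv f 0) = koebe_rate \<sigma> * cmod (deriv w 0)"
    | "ball 0 (\<sigma>\<^sup>2) \<subseteq> f ` ball 0 1"
proof (cases "sphere 0 (\<sigma>\<^sup>2) \<subseteq> f ` ball 0 1")
  case True
  then show thesis
    using that(2) sphere_subset_imp_ball_subset[OF f] \<sigma> by simp
next
  case False
  then obtain p where p: "cmod p = \<sigma>\<^sup>2" "p \<notin> f ` ball 0 1"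
    unfolding subset_iff by auto
  have s: "cmod (csqrt p) = \<sigma>" "(csqrt p)\<^sup>2 \<notin> f ` ball 0 1"
    using p \<sigma> by simp_all
  obtain w where w: "univalent_self_map w" "\<And>z. cmod z < 1 \<Longrightarrow> koebe_map (csqrt p) (w z) = f z"
    using koebe_lift_omitted[OF f _ s(2)] s(1) \<sigma> by metis
  then have "cmod (deriv f 0) = koebe_rate \<sigma> * cmod (deriv w 0)"
    using deriv_koebe_comp[of w "csqrt p" f] s(1) \<sigma> by (auto simp: univalent_self_map_def)
  then show thesis
    using that(1) s(1) w by blast
qed

text \<open>The dilation by \<open>r\<close> is subordinate to \<open>f\<close>.\<close>

lemma deriv_ge_of_ball_subset:
  assumes f: "univalent_self_map f" and r: "0 < r" and sub: "ball 0 r \<subseteq> f ` ball 0 1"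
  shows "r \<le> cmod (deriv f 0)"
proof -
  have "(\<lambda>z. of_real r * z :: complex) ` ball 0 1 \<subseteq> ball 0 r"
    using r by (simp add: image_subset_iff norm_mult)
  then have "(\<lambda>z. of_real r * z) ` ball 0 1 \<subseteq> f ` ball 0 1"
    using sub by blast
  moreover have "(\<lambda>z. of_real r * z) holomorphic_on ball 0 1"
    by (intro holomorphic_intros)
  ultimately have "cmod (deriv (\<lambda>z. of_real r * z) 0) \<le> cmod (deriv f 0)"
    using f by (intro subordinate_deriv_le) (auto simp: univalent_self_map_def disk_self_map_def)
  then show ?thesis
    using r by simp
qed

text \<open>The terminal case of the induction: Schwarz's lemma gives the inequality with constant
  1, and the factor here is at least 1.\<close>

lemma Pick_inequality_of_ball_subset:
  assumes f: "univalent_self_map f" and \<sigma>: "0 < \<sigma>" "\<sigma> < 1" and q: "cmod q < 1"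
    and sub: "ball 0 (\<sigma>\<^sup>2) \<subseteq> f ` ball 0 1"
  shows "(1 - cmod q)\<^sup>2 * cmod (f q) \<le>
    (cmod (deriv f 0) / \<sigma>\<^sup>2) powr koebe_rate \<sigma> * (1 - cmod (f q))\<^sup>2 * cmod q"
proof -
  have le: "cmod (f q) \<le> cmod q"
    using f disk_self_map_Schwarz(1)[of f q] q by (simp add: univalent_self_map_def)
  have "1 \<le> cmod (deriv f 0) / \<sigma>\<^sup>2"
    using deriv_ge_of_ball_subset[OF f _ sub] \<sigma> by simp
  then have K: "1 \<le> (cmod (deriv f 0) / \<sigma>\<^sup>2) powr koebe_rate \<sigma>"
    using koebe_rate_bounds[OF \<sigma>] by (intro ge_one_powr_ge_zero) auto
  have "(1 - cmod q)\<^sup>2 * cmod (f q) \<le> (1 - cmod (f q))\<^sup>2 * cmod q"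
    using le q by (intro mult_mono power_mono) auto
  also have "\<dots> \<le> (cmod (deriv f 0) / \<sigma>\<^sup>2) powr koebe_rate \<sigma> * ((1 - cmod (f q))\<^sup>2 * cmod q)"
    using mult_right_mono[OF K, of "(1 - cmod (f q))\<^sup>2 * cmod q"] by simp
  finally show ?thesis by (simp add: mult.assoc)
qed

text \<open>Induction over successive lifts \<open>f = koebe_map s o w\<close>. The boundary
  estimate for \<open>koebe_map s\<close> costs \<open>b powr b\<close>, exactly the change from
  \<open>cmod (deriv w 0) powr b\<close> to \<open>cmod (deriv f 0) powr b\<close>. The strict bound
  ends the process, since \<open>n = 0\<close> contradicts Schwarz's lemma.\<close>

lemma Pick_inequality_approx:
  assumes "univalent_self_map f" and \<sigma>: "0 < \<sigma>" "\<sigma> < 1" and q: "cmod q < 1"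
    and "koebe_rate \<sigma> ^ n < cmod (deriv f 0)"
  shows "(1 - cmod q)\<^sup>2 * cmod (f q) \<le>
    (cmod (deriv f 0) / \<sigma>\<^sup>2) powr koebe_rate \<sigma> * (1 - cmod (f q))\<^sup>2 * cmod q"
  using assms(1,5)
proof (induction n arbitrary: f)
  case (0 f)
  then show ?case
    using disk_self_map_Schwarz(2)[of f] by (simp add: univalent_self_map_def)
next
  case (Suc n f)
  define b where "b = koebe_rate \<sigma>"
  have b: "0 < b" "b < 1" using koebe_rate_bounds[OF \<sigma>] by (auto simp: b_def)
  from Suc.prems(1) \<sigma> show ?case
  proof (cases rule: koebe_lift_or_ball_subset)
    case (1 s w)
    have w: "univalent_self_map w" "\<And>z. cmod z < 1 \<Longrightarrow> koebe_map s (w z) = f z"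
      and s: "cmod s < 1" and dw: "cmod (deriv f 0) = b * cmod (deriv w 0)"
      using 1 \<sigma> by (auto simp: b_def)
    define x y P where "x = cmod q" and "y = cmod (w q)" and "P = cmod (f q)"
    define K where "K = (cmod (deriv w 0) / \<sigma>\<^sup>2) powr b"
    have "b ^ n < cmod (deriv w 0)"
      using Suc.prems(2) b dw by (simp add: b_def)
    then have IH: "(1 - x)\<^sup>2 * y \<le> K * (1 - y)\<^sup>2 * x"
      using Suc.IH[OF w(1)] by (simp add: x_def y_def K_def b_def)
    have wq: "cmod (w q) < 1"
      using w(1) q by (auto simp: univalent_self_map_def disk_self_map_def)
    have "(1 - y)\<^sup>2 * P \<le> ((1 + b) / 2)\<^sup>2 * (1 - P)\<^sup>2 * y"
      using disk_self_map_boundary_distance[OF disk_self_map_koebe[OF s] wq] w(2)[OF q]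
        norm_deriv_koebe[OF s] 1 by (simp add: y_def P_def b_def)
    also have "\<dots> \<le> b powr b * (1 - P)\<^sup>2 * y"
      using half_sum_square_le_powr[of b] b by (intro mult_right_mono) (auto simp: y_def)
    finally have step: "(1 - y)\<^sup>2 * P \<le> b powr b * (1 - P)\<^sup>2 * y" .
    have Kb: "K * b powr b = (cmod (deriv f 0) / \<sigma>\<^sup>2) powr b"
      using b by (simp add: K_def dw powr_mult[symmetric] mult.commute)
    have "(1 - x)\<^sup>2 * P \<le> (K * b powr b) * (1 - P)\<^sup>2 * x"
    \<comment> \<open>The two estimates are chained by cancelling \<open>y\<close>, so
      \<open>w q = 0\<close> is treated apart; then \<open>f q = 0\<close>.\<close>
    proof (cases "y = 0")
      case True
      then have "f q = 0"
        using w(2)[OF q] disk_self_mapD(2)[OF disk_self_map_koebe[OF s]] by (simp add: y_def)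
      then show ?thesis by (simp add: P_def K_def x_def)
    next
      case False
      then have y: "y > 0" by (simp add: y_def)
      have "y * ((1 - x)\<^sup>2 * P) = ((1 - x)\<^sup>2 * y) * P" by simp
      also have "\<dots> \<le> (K * (1 - y)\<^sup>2 * x) * P"
        using IH by (intro mult_right_mono) (auto simp: P_def)
      also have "\<dots> = (K * x) * ((1 - y)\<^sup>2 * P)" by simp
      also have "\<dots> \<le> (K * x) * (b powr b * (1 - P)\<^sup>2 * y)"
        using step by (intro mult_left_mono) (auto simp: K_def x_def)
      also have "\<dots> = y * ((K * b powr b) * (1 - P)\<^sup>2 * x)" by simp
      finally show ?thesis
        using y by (subst (asm) mult_le_cancel_left_pos) auto
    qed
    then show ?thesis
      unfolding Kb by (simp add: x_def P_def b_def)
  next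
    case 2
    then show ?thesis by (rule Pick_inequality_of_ball_subset[OF Suc.prems(1) \<sigma> q])
  qed
qed

text \<open>The number of lifts depends on \<sigma> but does not occur in the bound, so \<sigma> may
  tend to 1; the exponent and \<open>\<sigma>\<^sup>2\<close> then tend to 1.\<close>

lemma Pick_inequality:
  assumes f: "univalent_self_map f" and q: "cmod q < 1"
  shows "(1 - cmod q)\<^sup>2 * cmod (f q) \<le> cmod (deriv f 0) * (1 - cmod (f q))\<^sup>2 * cmod q"
proof -
  define m where "m = cmod (deriv f 0)"
  have m: "m > 0" using univalent_deriv_0_nonzero[OF f] by (simp add: m_def)
  let ?R = "\<lambda>\<sigma>. (m / \<sigma>\<^sup>2) powr koebe_rate \<sigma> * (1 - cmod (f q))\<^sup>2 * cmod q"
  have "(?R \<longlongrightarrow> (m / 1\<^sup>2) powr koebe_rate 1 * (1 - cmod (f q))\<^sup>2 * cmod q) (at_left 1)"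
    using m unfolding koebe_rate_def
    by (intro tendsto_intros) auto
  then have "(?R \<longlongrightarrow> m * (1 - cmod (f q))\<^sup>2 * cmod q) (at_left 1)"
    using m by (simp add: koebe_rate_def)
  moreover have "eventually (\<lambda>\<sigma>. (1 - cmod q)\<^sup>2 * cmod (f q) \<le> ?R \<sigma>) (at_left 1)"
  proof (rule eventually_mono[OF eventually_at_left_real[of 0 1]])
    fix \<sigma> :: real assume "\<sigma> \<in> {0<..<1}"
    then have \<sigma>: "0 < \<sigma>" "\<sigma> < 1" by auto
    obtain n where "koebe_rate \<sigma> ^ n < m"
      using real_arch_pow_inv[OF m koebe_rate_bounds(2)[OF \<sigma>]] by blast
    then show "(1 - cmod q)\<^sup>2 * cmod (f q) \<le> ?R \<sigma>"
      using Pick_inequality_approx[OF f \<sigma> q, of n] by (simp add: m_def)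
  qed simp
  ultimately show ?thesis
    unfolding m_def by (intro tendsto_lowerbound) auto
qed

section \<open>Common subordination\<close>

lemma koebe_rate_defect:
  assumes "0 < x"
  shows "1 / koebe_rate x - 1 = (1 - x)\<^sup>2 / (2 * x)"
  using assms by (simp add: koebe_rate_def field_simps power2_eq_square)

text \<open>Pick's inequality at \<open>q = t\<^sup>2\<close> compares the cost of branching the
  argument with that of branching the image. The factor
  \<open>(1 + \<sigma>)\<^sup>2 / (4 * \<sigma>)\<close> remains because
  \<open>(1 + x)\<^sup>2 \<ge> 4 * x\<close> is applied on the side of \<open>t\<close>
  only.\<close>

lemma koebe_rate_defect_le:
  assumes f: "univalent_self_map f" and \<sigma>: "0 < \<sigma>" "\<sigma> < 1" and t: "cmod t < 1" "t \<noteq> 0"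
    and ft: "cmod (f (t\<^sup>2)) = \<sigma>\<^sup>2"
  shows "1 / koebe_rate (cmod t) - 1 \<le>
    cmod (deriv f 0) * ((1 + \<sigma>)\<^sup>2 / (4 * \<sigma>)) * (1 / koebe_rate \<sigma> - 1)"
proof -
  define x where "x = cmod t"
  define m where "m = cmod (deriv f 0)"
  have x: "0 < x" "x < 1" using t by (auto simp: x_def)
  have "(1 - x\<^sup>2)\<^sup>2 * \<sigma>\<^sup>2 \<le> m * (1 - \<sigma>\<^sup>2)\<^sup>2 * x\<^sup>2"
    using Pick_inequality[OF f norm_power2_less_1[OF t(1)]]
    by (simp add: ft m_def x_def norm_power)
  then have pick: "(1 - x\<^sup>2)\<^sup>2 / x\<^sup>2 \<le> m * (1 - \<sigma>\<^sup>2)\<^sup>2 / \<sigma>\<^sup>2"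
    using x \<sigma> by (simp add: divide_simps mult.commute)
  have "4 * x \<le> (1 + x)\<^sup>2"
    using zero_le_power2[of "1 - x"] by (simp add: power2_eq_square algebra_simps)
  then have "(1 - x)\<^sup>2 * (4 * x) \<le> (1 - x)\<^sup>2 * (1 + x)\<^sup>2"
    by (intro mult_left_mono) auto
  also have "\<dots> = (1 - x\<^sup>2)\<^sup>2"
    by (simp add: power2_eq_square algebra_simps)
  finally have "(1 - x)\<^sup>2 / (2 * x) \<le> (1 - x\<^sup>2)\<^sup>2 / x\<^sup>2 / 8"
    using x by (simp add: divide_simps power2_eq_square) (simp add: algebra_simps)
  also have "\<dots> \<le> m * (1 - \<sigma>\<^sup>2)\<^sup>2 / \<sigma>\<^sup>2 / 8"
    using pick by (rule divide_right_mono) simp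
  also have "\<dots> = m * ((1 + \<sigma>)\<^sup>2 / (4 * \<sigma>)) * ((1 - \<sigma>)\<^sup>2 / (2 * \<sigma>))"
    using \<sigma> by (simp add: divide_simps) (simp add: power2_eq_square algebra_simps)
  finally show ?thesis
    using x \<sigma> by (simp add: koebe_rate_defect x_def m_def)
qed

text \<open>Lifting \<open>g\<close> once through \<open>koebe_map s\<close> with \<open>\<bar>s\<bar> = \<sigma>\<close> divides its derivative at 0 by the fixed
  number \<open>koebe_rate \<sigma> < 1\<close>, so the induction terminates. The constant \<open>C\<close>, which tends to 1 as
  \<open>\<sigma>\<close> tends to 1, absorbs the error of a single step.\<close>

lemma common_subordination_approx:
  assumes "univalent_self_map f" "univalent_self_map g" and \<sigma>: "0 < \<sigma>" "\<sigma> < 1"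
    and "koebe_rate \<sigma> ^ n < cmod (deriv g 0)"
  defines "C \<equiv> (1 + \<sigma>)\<^sup>2 / (4 * \<sigma>)"
  shows "\<exists>h. disk_self_map h \<and> (\<lambda>z. f (h z)) ` ball 0 1 \<subseteq> g ` ball 0 1 \<and>
    \<sigma>\<^sup>2 \<le> cmod (deriv h 0) * (1 + cmod (deriv f 0) * C * (1 / cmod (deriv g 0) - 1))"
  using assms(1,2,5)
proof (induction n arbitrary: f g)
  case (0 f g)
  then show ?case
    using disk_self_map_Schwarz(2)[of g] by (simp add: univalent_self_map_def)
next
  case (Suc n f g)
  define b where "b = koebe_rate \<sigma>"
  define m where "m = cmod (deriv f 0)"
  define d where "d = cmod (deriv g 0)"
  have b: "0 < b" "b < 1" using koebe_rate_bounds[OF \<sigma>] by (auto simp: b_def)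
  have m: "0 < m" and d: "0 < d" "d \<le> 1"
    using univalent_deriv_0_nonzero Suc.prems(1,2) disk_self_map_Schwarz(2)[of g]
    by (auto simp: m_def d_def univalent_self_map_def)
  have C: "1 \<le> C"
    using zero_le_power2[of "1 - \<sigma>"] \<sigma> by (simp add: C_def power2_eq_square field_simps)
  have f: "disk_self_map f" and g: "disk_self_map g"
    using Suc.prems(1,2) by (auto simp: univalent_self_map_def)
  from Suc.prems(2) \<sigma> show ?case
  proof (cases rule: koebe_lift_or_ball_subset)
    case (1 s g1)
    have s: "cmod s < 1" using 1 \<sigma> by simp
    define d1 where "d1 = cmod (deriv g1 0)"
    have dd1: "d = b * d1" using 1 by (simp add: d_def d1_def b_def)
    have d1: "0 < d1" using d dd1 b by (simp add: zero_less_mult_iff)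
    have n: "koebe_rate \<sigma> ^ n < cmod (deriv g1 0)"
      using Suc.prems(3) b dd1 by (simp add: b_def d_def d1_def)
    have lift: "koebe_map s ` g1 ` ball 0 1 \<subseteq> g ` ball 0 1"
      using 1(3) by (force simp: image_iff)
    show ?thesis
    proof (cases "s\<^sup>2 \<in> f ` ball 0 1")
      case False
      then obtain f1 where f1: "univalent_self_map f1"
          "\<And>z. cmod z < 1 \<Longrightarrow> koebe_map s (f1 z) = f z"
        using koebe_lift_omitted[OF Suc.prems(1) s] by metis
      define m1 where "m1 = cmod (deriv f1 0)"
      have m1: "m = b * m1"
        using deriv_koebe_comp[OF _ s f1(2)] f1(1) 1(1)
        by (simp add: m_def m1_def b_def univalent_self_map_def)
      obtain h where h: "disk_self_map h" "(\<lambda>z. f1 (h z)) ` ball 0 1 \<subseteq> g1 ` ball 0 1"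
          "\<sigma>\<^sup>2 \<le> cmod (deriv h 0) * (1 + m1 * C * (1 / d1 - 1))"
        using Suc.IH[OF f1(1) 1(2) n] unfolding m1_def d1_def by blast
      \<comment> \<open>Lifting both maps multiplies both derivatives by \<open>1 / b\<close>; the
        only net effect is that 1 becomes \<open>1 / b\<close>, which is favourable.\<close>
      have "m1 * C * (1 / d1 - 1) = m * C * (1 / d - 1 / b)"
        using b d1 by (simp add: m1 dd1 field_simps)
      also have "\<dots> \<le> m * C * (1 / d - 1)"
        using b C m by (intro mult_left_mono) auto
      finally have "\<sigma>\<^sup>2 \<le> cmod (deriv h 0) * (1 + m * C * (1 / d - 1))"
        using h(3) by (meson add_left_mono mult_left_mono norm_ge_zero order_trans)
      moreover have "(\<lambda>z. f (h z)) ` ball 0 1 \<subseteq> g ` ball 0 1"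
      proof -
        have "f (h z) \<in> koebe_map s ` g1 ` ball 0 1" if "z \<in> ball 0 1" for z
          using f1(2)[of "h z"] disk_self_mapD(3)[OF h(1), of z] h(2) that
          by (metis (no_types, lifting) image_eqI image_subset_iff mem_ball_0)
        then show ?thesis using lift by blast
      qed
      ultimately show ?thesis
        using h(1) by (auto simp: m_def d_def)
    next
      case True
      then obtain q where q: "cmod q < 1" "f q = s\<^sup>2" by auto
      define t where "t = csqrt q"
      have tq: "t\<^sup>2 = q" by (simp add: t_def)
      have "q \<noteq> 0" using q(2) 1(1) \<sigma> disk_self_mapD(2)[OF f] by auto
      then have t: "cmod t < 1" "t \<noteq> 0"
        using q(1) by (auto simp: t_def real_less_lsqrt)
      obtain f1 where f1: "univalent_self_map f1"
          "\<And>z. cmod z < 1 \<Longrightarrow> koebe_map s (f1 z) = f (koebe_map t z)"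
        using koebe_lift_attained[OF Suc.prems(1) s t] q(2) tq by metis
      define m1 where "m1 = cmod (deriv f1 0)"
      define a where "a = koebe_rate (cmod t)"
      have a: "0 < a" "a < 1" using koebe_rate_bounds[of "cmod t"] t by (auto simp: a_def)
      have m1: "m * a = b * m1"
        using deriv_koebe_comp[OF _ s f1(2)] deriv_comp_koebe[OF f t(1)] f1(1) 1(1)
        by (simp add: m_def m1_def b_def a_def univalent_self_map_def)
      have defect: "1 / a - 1 \<le> m * C * (1 / b - 1)"
        using koebe_rate_defect_le[OF Suc.prems(1) \<sigma> t] q(2) tq 1(1)
        by (simp add: a_def m_def C_def b_def norm_power)
      obtain h where h: "disk_self_map h" "(\<lambda>z. f1 (h z)) ` ball 0 1 \<subseteq> g1 ` ball 0 1"
          "\<sigma>\<^sup>2 \<le> cmod (deriv h 0) * (1 + m1 * C * (1 / d1 - 1))"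
        using Suc.IH[OF f1(1) 1(2) n] unfolding m1_def d1_def by blast
      let ?h = "\<lambda>z. koebe_map t (h z)"
      have h': "disk_self_map ?h"
        by (rule disk_self_map_compose[OF disk_self_map_koebe[OF t(1)] h(1)])
      have dh: "cmod (deriv ?h 0) = a * cmod (deriv h 0)"
        using deriv_koebe_comp[OF h(1) t(1), of ?h] by (simp add: a_def)
      have m1_factor: "m1 * C * (1 / d1 - 1) = a * (m * C * (1 / d - 1 / b))"
      proof -
        have m1_eq: "m1 = m * a / b" using m1 b by (simp add: field_simps)
        show ?thesis unfolding m1_eq dd1 using b d1 by (simp add: field_simps)
      qed
      \<comment> \<open>Branching the argument costs the factor \<open>a\<close>. Pulling it out
        leaves the surplus \<open>1 / a - 1\<close>, which \<open>defect\<close> bounds by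
        \<open>m * C * (1 / b - 1)\<close>; this telescopes with
        \<open>1 / d - 1 / b\<close>.\<close>
      have "1 + m1 * C * (1 / d1 - 1) = a * (1 + (1 / a - 1) + m * C * (1 / d - 1 / b))"
        unfolding m1_factor using a by (simp add: distrib_left)
      also have "\<dots> \<le> a * (1 + m * C * (1 / b - 1) + m * C * (1 / d - 1 / b))"
        using defect a by (intro mult_left_mono) auto
      also have "\<dots> = a * (1 + m * C * (1 / d - 1))"
        by (simp add: algebra_simps)
      finally have "\<sigma>\<^sup>2 \<le> cmod (deriv h 0) * (a * (1 + m * C * (1 / d - 1)))"
        using h(3) by (meson mult_left_mono norm_ge_zero order_trans)
      then have "\<sigma>\<^sup>2 \<le> cmod (deriv ?h 0) * (1 + m * C * (1 / d - 1))"
        by (simp add: dh mult_ac)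
      moreover have "(\<lambda>z. f (?h z)) ` ball 0 1 \<subseteq> g ` ball 0 1"
      proof -
        have "f (?h z) \<in> koebe_map s ` g1 ` ball 0 1" if "z \<in> ball 0 1" for z
          using f1(2)[of "h z"] disk_self_mapD(3)[OF h(1), of z] h(2) that
          by (metis (no_types, lifting) image_eqI image_subset_iff mem_ball_0)
        then show ?thesis using lift by blast
      qed
      ultimately show ?thesis
        using h' by (auto simp: m_def d_def)
    qed
  next
    case 2
    let ?h = "\<lambda>z. of_real (\<sigma>\<^sup>2) * z :: complex"
    have \<sigma>2: "0 < \<sigma>\<^sup>2" "\<sigma>\<^sup>2 < 1" using \<sigma> by (auto simp: abs_square_less_1)
    have hz: "cmod (?h z) < \<sigma>\<^sup>2" if "cmod z < 1" for z
      using that \<sigma>2 by (simp add: norm_mult norm_power)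
    have "disk_self_map ?h"
      using hz \<sigma>2 by (force simp: disk_self_map_def intro!: holomorphic_intros)
    moreover have "f (?h z) \<in> g ` ball 0 1" if "cmod z < 1" for z
    proof -
      have "cmod (f (?h z)) < \<sigma>\<^sup>2"
        using disk_self_map_Schwarz(1)[OF f, of "?h z"] hz[OF that] \<sigma>2 by linarith
      then show ?thesis using 2 by auto
    qed
    moreover have "\<sigma>\<^sup>2 \<le> cmod (deriv ?h 0) * (1 + m * C * (1 / d - 1))"
    proof -
      have "0 \<le> m * C * (1 / d - 1)" using m C d by (intro mult_nonneg_nonneg) auto
      then have "\<sigma>\<^sup>2 * 1 \<le> \<sigma>\<^sup>2 * (1 + m * C * (1 / d - 1))"
        by (intro mult_left_mono) auto
      then show ?thesis by (simp add: norm_power)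
    qed
    ultimately show ?thesis
      unfolding m_def d_def by (intro exI[of _ ?h]) auto
  qed
qed

text \<open>The maps \<open>h\<close> vary with \<sigma>. A uniform bound \<open>K\<close> on their
  derivatives allows the limit \<sigma> to 1 without extracting a limit map.\<close>

lemma common_subordination_bound:
  assumes f: "univalent_self_map f" and g: "univalent_self_map g"
    and K: "\<And>h. disk_self_map h \<Longrightarrow> (\<lambda>z. f (h z)) ` ball 0 1 \<subseteq> g ` ball 0 1 \<Longrightarrow>
      cmod (deriv h 0) \<le> K"
  shows "1 \<le> K * (1 + cmod (deriv f 0) * (1 / cmod (deriv g 0) - 1))"
proof -
  define m where "m = cmod (deriv f 0)"
  define d where "d = cmod (deriv g 0)"
  have d: "0 < d" "d \<le> 1"
    using univalent_deriv_0_nonzero[OF g] disk_self_map_Schwarz(2)[of g] g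
    by (auto simp: d_def univalent_self_map_def)
  let ?R = "\<lambda>\<sigma>::real. K * (1 + m * ((1 + \<sigma>)\<^sup>2 / (4 * \<sigma>)) * (1 / d - 1))"
  have "(?R \<longlongrightarrow> K * (1 + m * ((1 + 1)\<^sup>2 / (4 * 1)) * (1 / d - 1))) (at_left 1)"
    by (intro tendsto_intros) auto
  moreover have "((\<lambda>\<sigma>::real. \<sigma>\<^sup>2) \<longlongrightarrow> 1\<^sup>2) (at_left 1)"
    by (intro tendsto_intros)
  moreover have "eventually (\<lambda>\<sigma>. \<sigma>\<^sup>2 \<le> ?R \<sigma>) (at_left 1)"
  proof (rule eventually_mono[OF eventually_at_left_real[of 0 1]])
    fix \<sigma> :: real assume "\<sigma> \<in> {0<..<1}"
    then have \<sigma>: "0 < \<sigma>" "\<sigma> < 1" by auto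
    obtain n where n: "koebe_rate \<sigma> ^ n < d"
      using real_arch_pow_inv[OF d(1) koebe_rate_bounds(2)[OF \<sigma>]] by blast
    obtain h where h: "disk_self_map h" "(\<lambda>z. f (h z)) ` ball 0 1 \<subseteq> g ` ball 0 1"
        "\<sigma>\<^sup>2 \<le> cmod (deriv h 0) * (1 + m * ((1 + \<sigma>)\<^sup>2 / (4 * \<sigma>)) * (1 / d - 1))"
      using common_subordination_approx[OF f g \<sigma>, of n] n unfolding m_def d_def by blast
    note h(3)
    also have "\<dots> \<le> ?R \<sigma>"
      using K[OF h(1,2)] d \<sigma> by (intro mult_right_mono add_nonneg_nonneg mult_nonneg_nonneg)
        (auto simp: m_def)
    finally show "\<sigma>\<^sup>2 \<le> ?R \<sigma>" .
  qed simp
  ultimately have "1\<^sup>2 \<le> K * (1 + m * ((1 + 1)\<^sup>2 / (4 * 1)) * (1 / d - 1))"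
    by (intro tendsto_le) auto
  then show ?thesis
    by (simp add: m_def d_def)
qed

section \<open>Hyperbolic densities of simply connected domains\<close>

definition riemann_map :: "(complex \<Rightarrow> complex) \<Rightarrow> complex set \<Rightarrow> complex \<Rightarrow> bool" where
  "riemann_map F S z \<longleftrightarrow>
     F holomorphic_on ball 0 1 \<and> inj_on F (ball 0 1) \<and> F ` ball 0 1 = S \<and> F 0 = z"

lemma riemann_map_exists:
  assumes "open S" "simply_connected S" "bounded S" "z \<in> S"
  obtains F where "riemann_map F S z"
proof -
  have "S \<noteq> UNIV" using assms(3) not_bounded_UNIV by auto
  then obtain f g where fg: "g holomorphic_on ball 0 1"
      "\<And>z. z \<in> S \<Longrightarrow> f z \<in> ball 0 1 \<and> g (f z) = z"
      "\<And>z. z \<in> ball 0 1 \<Longrightarrow> g z \<in> S \<and> f (g z) = z"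
    using Riemann_mapping_theorem[of S] assms by blast
  define a where "a = f z"
  have a: "cmod a < 1" "g a = z" using fg(2)[OF assms(4)] by (auto simp: a_def)
  let ?F = "\<lambda>w. g (disk_swap a w)"
  have swap: "disk_swap a w \<in> ball 0 1" if "w \<in> ball 0 1" for w
    using norm_disk_swap_less_1[OF a(1)] that by simp
  have hol: "?F holomorphic_on ball 0 1"
    by (rule holomorphic_on_disk_compose[OF fg(1) holomorphic_disk_swap[OF a(1)]
          norm_disk_swap_less_1[OF a(1)]])
  have inj: "inj_on ?F (ball 0 1)"
  proof (rule inj_onI)
    fix x y assume xy: "x \<in> ball 0 1" "y \<in> ball 0 1" "?F x = ?F y"
    then have "disk_swap a x = disk_swap a y"
      using fg(3) swap by metis
    then show "x = y"
      using xy a by (simp add: disk_swap_eq_iff)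
  qed
  have "S \<subseteq> ?F ` ball 0 1"
  proof
    fix y assume y: "y \<in> S"
    then have "?F (disk_swap a (f y)) = y"
      using fg(2)[OF y] disk_swap_involution[OF a(1), of "f y"] by simp
    then show "y \<in> ?F ` ball 0 1"
      using swap fg(2)[OF y] by (metis image_eqI)
  qed
  moreover have "?F ` ball 0 1 \<subseteq> S"
    using fg(3) swap by blast
  ultimately show thesis
    using hol inj a that[of ?F] by (auto simp: riemann_map_def)
qed

lemma riemann_map_deriv_nonzero: "riemann_map F S z \<Longrightarrow> deriv F 0 \<noteq> 0"
  unfolding riemann_map_def
  by (intro holomorphic_injective_imp_regular[of F "ball 0 1"]) auto

text \<open>Two opposite subordinations: \<open>p\<close> after \<open>disk_swap \<zeta>\<close> is
  subordinate to \<open>F\<close>, and \<open>F\<close>, lifted through the covering, factors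
  through \<open>p\<close>. Schwarz's lemma in both directions gives equal derivatives at 0, and the
  swap contributes \<open>1 - (cmod \<zeta>)\<^sup>2\<close>.\<close>

lemma universal_cover_deriv:
  assumes F: "riemann_map F G z" and p: "holomorphic_universal_cover p G"
    and \<zeta>: "cmod \<zeta> < 1" "p \<zeta> = z"
  shows "cmod (deriv p \<zeta>) * (1 - (cmod \<zeta>)\<^sup>2) = cmod (deriv F 0)"
proof -
  have Fh: "F holomorphic_on ball 0 1" and Fi: "inj_on F (ball 0 1)"
    and FG: "F ` ball 0 1 = G" and F0: "F 0 = z"
    using F by (auto simp: riemann_map_def)
  have ph: "p holomorphic_on ball 0 1" and cov: "covering_space (ball 0 1) p G"
    using p by (auto simp: holomorphic_universal_cover_def)
  have FG': "F \<in> ball 0 1 \<rightarrow> G" using FG by auto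
  obtain L where L: "continuous_on (ball 0 1) L" "L \<in> ball 0 1 \<rightarrow> ball 0 1" "L 0 = \<zeta>"
      "\<And>y. y \<in> ball 0 1 \<Longrightarrow> p (L y) = F y"
    using covering_space_lift_strong[OF cov, of \<zeta> 0 "ball 0 1" F] \<zeta> F0 FG'
      holomorphic_on_imp_continuous_on[OF Fh]
    by (auto simp: convex_imp_simply_connected convex_imp_locally_path_connected)
  have Lh: "L holomorphic_on ball 0 1"
    by (rule covering_space_lift_is_holomorphic[OF cov open_ball ph Fh FG' L(2,1,4)])
  have Ln: "cmod (L y) < 1" if "cmod y < 1" for y
    using L(2) that by (auto simp: Pi_iff)
  note swapn = norm_disk_swap_less_1[OF \<zeta>(1)]
  let ?q = "\<lambda>y. p (disk_swap \<zeta> y)"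
  have qh: "?q holomorphic_on ball 0 1"
    by (rule holomorphic_on_disk_compose[OF ph holomorphic_disk_swap[OF \<zeta>(1)] swapn])
  have "?q ` ball 0 1 \<subseteq> F ` ball 0 1"
    using swapn covering_space_imp_surjective[OF cov] FG by fastforce
  moreover have "?q 0 = F 0" using \<zeta> F0 by simp
  ultimately have le: "cmod (deriv ?q 0) \<le> cmod (deriv F 0)"
    by (intro subordinate_deriv_le Fh Fi qh)
  have lift: "disk_self_map (\<lambda>y. disk_swap \<zeta> (L y))"
    unfolding disk_self_map_def
    using holomorphic_on_disk_compose[OF holomorphic_disk_swap[OF \<zeta>(1)] Lh Ln] Ln swapn L(3)
    by auto
  have "deriv F 0 = deriv ?q (disk_swap \<zeta> (L 0)) * deriv (\<lambda>y. disk_swap \<zeta> (L y)) 0"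
    by (rule deriv_comp_on_disk[OF qh])
      (use lift L(3,4) Ln \<zeta>(1) in \<open>auto simp: disk_self_map_def disk_swap_involution\<close>)
  then have "cmod (deriv F 0) = cmod (deriv ?q 0) * cmod (deriv (\<lambda>y. disk_swap \<zeta> (L y)) 0)"
    using L(3) by (simp add: norm_mult)
  also have "\<dots> \<le> cmod (deriv ?q 0)"
    using disk_self_map_Schwarz(2)[OF lift] by (simp add: mult_left_le)
  finally have eq: "cmod (deriv ?q 0) = cmod (deriv F 0)"
    using le by simp
  have "deriv ?q 0 = deriv p (disk_swap \<zeta> 0) * deriv (disk_swap \<zeta>) 0"
    by (rule deriv_comp_on_disk[OF ph holomorphic_disk_swap[OF \<zeta>(1)]]) (use \<zeta> in auto)
  then have "cmod (deriv ?q 0) = cmod (deriv p \<zeta>) * cmod (cnj \<zeta> * \<zeta> - 1)"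
    using \<zeta> by (simp add: norm_mult deriv_disk_swap)
  also have "cmod (cnj \<zeta> * \<zeta> - 1) = 1 - (cmod \<zeta>)\<^sup>2"
  proof -
    have "cnj \<zeta> * \<zeta> - 1 = of_real ((cmod \<zeta>)\<^sup>2 - 1)"
      using complex_norm_square[of \<zeta>] by (simp add: mult.commute)
    then have "cmod (cnj \<zeta> * \<zeta> - 1) = \<bar>(cmod \<zeta>)\<^sup>2 - 1\<bar>"
      by (simp only: norm_of_real)
    then show ?thesis
      using \<zeta>(1) abs_square_less_1[of "cmod \<zeta>"] by simp
  qed
  finally show ?thesis using eq by simp
qed

text \<open>Existence: \<open>F\<close> is itself a cover, and 0 is its only preimage of
  \<open>z\<close>. Uniqueness: \<open>universal_cover_deriv\<close> forces the same value from
  every other cover.\<close>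

lemma hyperbolic_density_riemann_map:
  assumes F: "riemann_map F G z"
  shows "hyperbolic_density G z = 1 / cmod (deriv F 0)"
  unfolding hyperbolic_density_def
proof (rule the_equality)
  have Fh: "F holomorphic_on ball 0 1" and Fi: "inj_on F (ball 0 1)"
    and FG: "F ` ball 0 1 = G" and F0: "F 0 = z"
    using F by (auto simp: riemann_map_def)
  obtain f where "homeomorphism (ball 0 1) (F ` ball 0 1) F f"
    using invariance_of_domain_homeomorphism[OF open_ball holomorphic_on_imp_continuous_on[OF Fh] _ Fi]
    by auto
  then have "holomorphic_universal_cover F G"
    using Fh FG homeomorphism_imp_covering_space by (auto simp: holomorphic_universal_cover_def)
  moreover have "1 / cmod (deriv F 0) * cmod (deriv F \<zeta>) = disk_density \<zeta>"
    if "\<zeta> \<in> ball 0 1" "F \<zeta> = z" for \<zeta>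
  proof -
    have "\<zeta> = 0" using inj_onD[OF Fi, of \<zeta> 0] that F0 by simp
    then show ?thesis using riemann_map_deriv_nonzero[OF F] by (simp add: disk_density_def)
  qed
  ultimately show "\<exists>p. holomorphic_universal_cover p G \<and>
      (\<forall>\<zeta>\<in>ball 0 1. p \<zeta> = z \<longrightarrow> 1 / cmod (deriv F 0) * cmod (deriv p \<zeta>) = disk_density \<zeta>)"
    by blast
  fix r
  assume "\<exists>p. holomorphic_universal_cover p G \<and>
      (\<forall>\<zeta>\<in>ball 0 1. p \<zeta> = z \<longrightarrow> r * cmod (deriv p \<zeta>) = disk_density \<zeta>)"
  then obtain p where p: "holomorphic_universal_cover p G"
      "\<And>\<zeta>. \<zeta> \<in> ball 0 1 \<Longrightarrow> p \<zeta> = z \<Longrightarrow> r * cmod (deriv p \<zeta>) = disk_density \<zeta>"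
    by blast
  have "z \<in> G" using F0 FG by force
  then obtain \<zeta> where \<zeta>: "cmod \<zeta> < 1" "p \<zeta> = z"
    using p(1) covering_space_imp_surjective[of "ball 0 1" p G]
    by (force simp: holomorphic_universal_cover_def)
  have "(cmod \<zeta>)\<^sup>2 < 1" using \<zeta>(1) by (simp add: abs_square_less_1)
  then have "r * (cmod (deriv p \<zeta>) * (1 - (cmod \<zeta>)\<^sup>2)) = 1"
    using p(2)[of \<zeta>] \<zeta> by (simp add: disk_density_def field_simps)
  then have "r * cmod (deriv F 0) = 1"
    using universal_cover_deriv[OF F p(1) \<zeta>] by simp
  then show "r = 1 / cmod (deriv F 0)"
    using riemann_map_deriv_nonzero[OF F] by (simp add: field_simps)
qed

text \<open>A hole \<open>C\<close> of the component would lie in \<open>S \<inter> T\<close>, hence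
  in another component \<open>E\<close>. As \<open>E\<close> avoids \<open>?D\<close>, it lies in
  \<open>C\<close>, so \<open>C = E\<close> would be open, closed, nonempty and bounded.\<close>

lemma simply_connected_component_Int:
  fixes S T :: "complex set"
  assumes S: "open S" "simply_connected S" and T: "open T" "simply_connected T"
  shows "simply_connected (connected_component_set (S \<inter> T) z)" (is "simply_connected ?D")
proof -
  have D: "open ?D" using S T by (intro open_connected_component) auto
  have "?D \<subseteq> S" "?D \<subseteq> T" using connected_component_subset[of "S \<inter> T" z] by auto
  then have ins: "inside ?D \<subseteq> S \<inter> T"
    using subset_simply_connected_imp_inside_subset S T by simp
  have "inside ?D = {}"
  proof (rule ccontr)
    assume "inside ?D \<noteq> {}"
    then obtain x where x: "x \<in> inside ?D" by blast
    define C where "C = connected_component_set (- ?D) x"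
    define E where "E = connected_component_set (S \<inter> T) x"
    have xD: "x \<notin> ?D" and bC: "bounded C" using x by (auto simp: inside_def C_def)
    have xC: "x \<in> C" using xD by (simp add: C_def connected_component_refl)
    have CD: "C \<subseteq> - ?D" unfolding C_def by (rule connected_component_subset)
    have "C \<subseteq> inside ?D"
    proof
      fix y assume y: "y \<in> C"
      then have "connected_component_set (- ?D) y = C"
        unfolding C_def by (rule connected_component_eq)
      then show "y \<in> inside ?D" using y CD bC unfolding inside_def by blast
    qed
    then have CE: "C \<subseteq> E"
      unfolding E_def using xC ins
      by (intro connected_component_maximal) (auto simp: C_def)
    have "E \<inter> ?D = {}"
    proof (rule ccontr)
      assume "E \<inter> ?D \<noteq> {}"
      then obtain y where "y \<in> E" "y \<in> ?D" by blast
      then have "E = ?D" unfolding E_def using connected_component_eq by metis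
      then show False using CE xC xD by blast
    qed
    then have "E \<subseteq> C"
      unfolding C_def using CE xC
      by (intro connected_component_maximal) (auto simp: E_def)
    then have "C = E" using CE by blast
    moreover have "open E" using S T unfolding E_def by (intro open_connected_component) auto
    moreover have "closed C" using D unfolding C_def by (intro closed_connected_component) auto
    ultimately have "C = {} \<or> C = UNIV" using clopen by metis
    then show False using xC bC not_bounded_UNIV by auto
  qed
  then show ?thesis
    using simply_connected_eq_empty_inside[OF D] by auto
qed

text \<open>Two points of the disk of radius \<open>R\<close> are less than \<open>2 * R\<close>
  apart. A scaling that depends only on \<open>z\<close> and \<open>R\<close> preserves inclusions
  between different domains.\<close>

lemma scaled_riemann_map_univalent:
  assumes F: "riemann_map F S z" and S: "S \<subseteq> ball 0 R"
  defines "f \<equiv> \<lambda>w. (F w - z) / of_real (2 * R)"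
  shows "univalent_self_map f" "cmod (deriv f 0) = cmod (deriv F 0) / (2 * R)"
proof -
  have Fh: "F holomorphic_on ball 0 1" and Fi: "inj_on F (ball 0 1)"
    and FS: "F ` ball 0 1 = S" and F0: "F 0 = z"
    using F by (auto simp: riemann_map_def)
  have FR: "cmod (F w) < R" if "cmod w < 1" for w
    using FS S that by (force simp: subset_iff)
  have z: "cmod z < R" using FR[of 0] F0 by simp
  then have R: "R > 0" using norm_ge_zero[of z] by linarith
  have "cmod (f w) < 1" if "cmod w < 1" for w
  proof -
    have "cmod (F w - z) < 2 * R"
      using norm_triangle_ineq4[of "F w" z] FR[OF that] z by linarith
    then show ?thesis using R by (simp add: f_def norm_divide)
  qed
  moreover have "f holomorphic_on ball 0 1"
    unfolding f_def using R by (intro holomorphic_intros Fh) auto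
  moreover have "inj_on f (ball 0 1)"
    using Fi R by (auto simp: inj_on_def f_def)
  ultimately show "univalent_self_map f"
    using F0 by (auto simp: univalent_self_map_def disk_self_map_def f_def)
  have "(F has_field_derivative deriv F 0) (at 0)"
    by (rule holomorphic_derivI[OF Fh]) auto
  then have "(f has_field_derivative deriv F 0 / of_real (2 * R)) (at 0)"
    unfolding f_def using R by (auto intro!: derivative_eq_intros)
  then have "deriv f 0 = deriv F 0 / of_real (2 * R)"
    by (rule DERIV_imp_deriv)
  then have "cmod (deriv f 0) = cmod (deriv F 0) / cmod (of_real (2 * R))"
    by (simp only: norm_divide)
  then show "cmod (deriv f 0) = cmod (deriv F 0) / (2 * R)"
    using R by (simp only: norm_of_real)
qed

text \<open>The constant \<open>K\<close> is \<open>\<delta> / \<alpha>\<close>: an admissible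
  \<open>h\<close> makes \<open>F\<close> after \<open>h\<close> map into \<open>D\<close>, hence
  subordinate to \<open>H\<close>. The gain \<open>1 / (2 * R)\<close> is the \<open>- 1\<close> of
  \<open>common_subordination_bound\<close> after scaling back.\<close>

lemma hyperbolic_density_Int_le:
  assumes S: "open S" "simply_connected S" "S \<subseteq> ball 0 R"
    and T: "open T" "simply_connected T" "T \<subseteq> ball 0 R"
    and z: "z \<in> S" "z \<in> T"
  defines "D \<equiv> connected_component_set (S \<inter> T) z"
  shows "hyperbolic_density D z + 1 / (2 * R) \<le> hyperbolic_density S z + hyperbolic_density T z"
    "0 < hyperbolic_density S z"
proof -
  have "cmod z < R" using S(3) z(1) by auto
  then have R: "R > 0" using norm_ge_zero[of z] by linarith
  have bd: "bounded S" "bounded T"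
    using S(3) T(3) bounded_ball bounded_subset by blast+
  obtain F where F: "riemann_map F S z"
    using riemann_map_exists[OF S(1,2) bd(1) z(1)] by blast
  obtain G where G: "riemann_map G T z"
    using riemann_map_exists[OF T(1,2) bd(2) z(2)] by blast
  have "open D" "simply_connected D"
    using simply_connected_component_Int[OF S(1,2) T(1,2)] S(1) T(1)
    by (auto simp: D_def intro!: open_connected_component)
  moreover have "bounded D"
    using connected_component_subset[of "S \<inter> T" z] bd(1) unfolding D_def
    by (meson bounded_subset le_infE)
  moreover have "z \<in> D" using z by (simp add: D_def connected_component_refl)
  ultimately obtain H where H: "riemann_map H D z"
    using riemann_map_exists by blast
  define \<alpha> \<beta> \<delta> where "\<alpha> = cmod (deriv F 0)" and "\<beta> = cmod (deriv G 0)" and "\<delta> = cmod (deriv H 0)"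
  have pos: "0 < \<alpha>" "0 < \<beta>" "0 < \<delta>"
    using F G H riemann_map_deriv_nonzero by (auto simp: \<alpha>_def \<beta>_def \<delta>_def)
  let ?f = "\<lambda>w. (F w - z) / of_real (2 * R)" and ?g = "\<lambda>w. (G w - z) / of_real (2 * R)"
  note f = scaled_riemann_map_univalent[OF F S(3)] and g = scaled_riemann_map_univalent[OF G T(3)]
  have "1 \<le> \<delta> / \<alpha> * (1 + cmod (deriv ?f 0) * (1 / cmod (deriv ?g 0) - 1))"
  proof (rule common_subordination_bound[OF f(1) g(1)])
    fix h assume h: "disk_self_map h" and sub: "(\<lambda>w. ?f (h w)) ` ball 0 1 \<subseteq> ?g ` ball 0 1"
    let ?u = "\<lambda>w. F (h w)"
    have Fh: "F holomorphic_on ball 0 1" and FS: "F ` ball 0 1 = S" and F0: "F 0 = z"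
      using F by (auto simp: riemann_map_def)
    note hD = disk_self_mapD[OF h]
    have u: "?u holomorphic_on ball 0 1"
      by (rule holomorphic_on_disk_compose[OF Fh hD(1,3)])
    have u0: "?u 0 = z" using hD F0 by simp
    have "?u w \<in> S \<inter> T" if w: "w \<in> ball 0 1" for w
    proof
      show "?u w \<in> S" using FS hD(3) w by auto
      obtain v where "v \<in> ball 0 1" "?f (h w) = ?g v" using sub w by blast
      then have "?u w = G v" using R by (simp add: field_simps)
      then show "?u w \<in> T" using G \<open>v \<in> ball 0 1\<close> by (auto simp: riemann_map_def)
    qed
    \<comment> \<open>Connectedness and the value \<open>z\<close> at 0 confine the image to the
      component \<open>D\<close>.\<close>
    moreover have "connected (?u ` ball 0 1)"
      using u by (intro connected_continuous_image holomorphic_on_imp_continuous_on) auto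
    moreover have "z \<in> ?u ` ball 0 1" using u0 by force
    ultimately have "?u ` ball 0 1 \<subseteq> D"
      unfolding D_def by (intro connected_component_maximal) auto
    then have "cmod (deriv ?u 0) \<le> \<delta>"
      unfolding \<delta>_def using H u u0 by (intro subordinate_deriv_le) (auto simp: riemann_map_def)
    moreover have "deriv ?u 0 = deriv F (h 0) * deriv h 0"
      by (rule deriv_comp_on_disk[OF Fh hD(1)]) (use hD in auto)
    ultimately show "cmod (deriv h 0) \<le> \<delta> / \<alpha>"
      using hD pos by (simp add: norm_mult \<alpha>_def field_simps)
  qed
  then have "1 \<le> \<delta> / \<alpha> * (1 + \<alpha> / (2 * R) * (1 / (\<beta> / (2 * R)) - 1))"
    by (simp only: f(2) g(2) \<alpha>_def \<beta>_def)
  also have "\<dots> = \<delta> * (1 / \<alpha> + 1 / \<beta> - 1 / (2 * R))"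
    using pos R by (simp add: field_simps)
  finally have "1 / \<delta> \<le> 1 / \<alpha> + 1 / \<beta> - 1 / (2 * R)"
    using pos by (simp add: divide_le_eq mult.commute)
  then show "hyperbolic_density D z + 1 / (2 * R) \<le> hyperbolic_density S z + hyperbolic_density T z"
    using hyperbolic_density_riemann_map[OF F] hyperbolic_density_riemann_map[OF G]
      hyperbolic_density_riemann_map[OF H] by (simp add: \<alpha>_def \<beta>_def \<delta>_def)
  show "0 < hyperbolic_density S z"
    using hyperbolic_density_riemann_map[OF F] pos by (simp add: \<alpha>_def)
qed

section \<open>Concentric disks and the value of the supremum\<close>

lemma hyperbolic_density_ball_centre:
  assumes "r > 0"
  shows "hyperbolic_density (ball 0 r) 0 = 1 / r"
proof -
  let ?F = "\<lambda>w::complex. of_real r * w"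
  have "w \<in> ?F ` ball 0 1" if "cmod w < r" for w
    using that assms by (intro image_eqI[of _ _ "w / of_real r"]) (auto simp: norm_divide)
  then have "?F ` ball 0 1 = ball 0 r"
    using assms by (auto simp: norm_mult)
  then have "riemann_map ?F (ball 0 r) 0"
    using assms by (auto simp: riemann_map_def inj_on_def intro!: holomorphic_intros)
  then show ?thesis
    using assms by (simp add: hyperbolic_density_riemann_map)
qed

lemma ball_in_sc_domains: "0 < r \<Longrightarrow> r \<le> R \<Longrightarrow> ball 0 r \<in> sc_domains R"
  by (auto simp: sc_domains_def complex_domain_def convex_imp_simply_connected)

lemma density_quotient_concentric_balls:
  assumes "0 < r" "r \<le> R"
  shows "density_quotient (ball 0 r) (ball 0 R) 0 = 1 / (1 + r / R)"
proof -
  have int: "ball 0 r \<inter> ball 0 R = ball (0::complex) r" using assms by auto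
  have "connected_component_set (ball 0 r) 0 = ball (0::complex) r"
    using assms by (simp add: connected_component_eq_self)
  then show ?thesis
    using assms by (simp add: density_quotient_def int hyperbolic_density_ball_centre field_simps)
qed

theorem theorem1p3:
  fixes R :: real
  assumes "R > 0"
  shows "A_sc R = 1"
proof (rule antisym)
  show "A_sc R \<le> 1"
    unfolding A_sc_def
  proof (rule Sup_least, clarify)
    fix D1 D2 z
    assume D: "D1 \<in> sc_domains R" "D2 \<in> sc_domains R" "z \<in> D1" "z \<in> D2"
    have sub: "open D" "simply_connected D" "D \<subseteq> ball 0 R" if "D \<in> sc_domains R" for D
      using that by (auto simp: sc_domains_def complex_domain_def)
    have "hyperbolic_density (connected_component_set (D1 \<inter> D2) z) z
        \<le> hyperbolic_density D1 z + hyperbolic_density D2 z"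
      using hyperbolic_density_Int_le(1)[OF sub[OF D(1)] sub[OF D(2)] D(3,4)] assms
        divide_nonneg_pos[of 1 "2 * R"] by linarith
    moreover have "0 < hyperbolic_density D1 z" "0 < hyperbolic_density D2 z"
      using hyperbolic_density_Int_le(2)[OF sub[OF D(1)] sub[OF D(2)] D(3,4)]
        hyperbolic_density_Int_le(2)[OF sub[OF D(2)] sub[OF D(1)] D(4,3)] by auto
    ultimately show "ereal (density_quotient D1 D2 z) \<le> 1"
      by (simp add: density_quotient_def)
  qed
next
  \<comment> \<open>Every concentric quotient is below 1, so the bound is reached only in the limit
    of a shrinking inner disk.\<close>
  have "((\<lambda>r. ereal (1 / (1 + r / R))) \<longlongrightarrow> ereal (1 / (1 + 0 / R))) (at_right 0)"
    using assms by (intro tendsto_intros) auto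
  moreover have "eventually (\<lambda>r. ereal (1 / (1 + r / R)) \<le> A_sc R) (at_right 0)"
  proof (rule eventually_mono[OF eventually_at_right_real[OF assms]])
    fix r assume "r \<in> {0<..<R}"
    then have r: "0 < r" "r \<le> R" by auto
    show "ereal (1 / (1 + r / R)) \<le> A_sc R"
      unfolding A_sc_def density_quotient_concentric_balls[OF r, symmetric]
      using r assms ball_in_sc_domains[OF r] ball_in_sc_domains[of R R]
      by (intro Sup_upper CollectI exI[of _ "ball 0 r"] exI[of _ "ball 0 R"] exI[of _ 0]) auto
  qed
  ultimately have "ereal (1 / (1 + 0 / R)) \<le> A_sc R"
    by (intro tendsto_upperbound) auto
  then show "1 \<le> A_sc R" by (simp add: one_ereal_def)
qed

end
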